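(* (a) Every extremal valued field is algebraically complete. (b) Every finite extension (with any extension of the valuation) of an extremal valued field is again extremal.
   Context: $(K,v)$ with valuation ring $\mathcal{O}_v$ and value group $\Gamma$ (and $v(0)=\infty$) is extremal if for every $n\ge1$ and every $F\in K[X_1,\dots,X_n]$ the set $\{v(F(a_1,\dots,a_n)) : a_i\in\mathcal{O}_v\}\subseteq\Gamma\cup\{\infty\}$ has a maximal element. $(K,v)$ is algebraically complete if it is henselian and every finite extension $(L,w)$, with value group $\Delta$ and residue field $l$, satisfies $[L:K]=(\Delta:\Gamma)[l:k]$, where $k$ is the residue field of $K$. *)

theory Defs
  imports Main "HOL-Library.Poly_Mapping" "HOL-Computational_Algebra.Polynomial"
begin

text \<open>A (Krull) valuation on the field 'a with values in the ordered abelian group 'g.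
  Only nonzero elements get a value; the value of 0 is the formal symbol infinity,
  which is handled explicitly below (x = 0 stands for v x = infinity).\<close>

definition valuation :: "('a::field \<Rightarrow> 'g::linordered_ab_group_add) \<Rightarrow> bool" where
  "valuation v \<longleftrightarrow>
     (\<forall>x y. x \<noteq> 0 \<longrightarrow> y \<noteq> 0 \<longrightarrow> v (x * y) = v x + v y) \<and>
     (\<forall>x y. x \<noteq> 0 \<longrightarrow> y \<noteq> 0 \<longrightarrow> x + y \<noteq> 0 \<longrightarrow> min (v x) (v y) \<le> v (x + y))"

definition val_ring :: "('a::field \<Rightarrow> 'g::linordered_ab_group_add) \<Rightarrow> 'a set" where
  "val_ring v = {x. x = 0 \<or> 0 \<le> v x}"

definition value_group :: "('a::field \<Rightarrow> 'g::linordered_ab_group_add) \<Rightarrow> 'g set" where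
  "value_group v = v ` {x. x \<noteq> 0}"

text \<open>A polynomial in K[X_0,...,X_{n-1}] is a finitely supported map from monomials
  (finitely supported exponent vectors) to coefficients, involving only the variables i < n.\<close>
definition mpoly_in_vars :: "nat \<Rightarrow> ((nat \<Rightarrow>\<^sub>0 nat) \<Rightarrow>\<^sub>0 ('a::zero)) \<Rightarrow> bool" where
  "mpoly_in_vars n F \<longleftrightarrow> (\<forall>m \<in> Poly_Mapping.keys F. Poly_Mapping.keys m \<subseteq> {..<n})"

definition mpoly_eval :: "((nat \<Rightarrow>\<^sub>0 nat) \<Rightarrow>\<^sub>0 ('a::comm_semiring_1)) \<Rightarrow> (nat \<Rightarrow> 'a) \<Rightarrow> 'a" where
  "mpoly_eval F a = (\<Sum>m \<in> Poly_Mapping.keys F. Poly_Mapping.lookup F m * (\<Prod>i \<in> Poly_Mapping.keys m. a i ^ Poly_Mapping.lookup m i))"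

text \<open>For every n \<ge> 1 and every F in K[X_1..X_n], the set
  {v(F(a)) : a \<in> O_v^n} \<subseteq> \<Gamma> \<union> {\<infinity>} has a maximal element
  (the maximum is \<infinity> iff F has a zero in O_v^n).\<close>
definition extremal :: "('a::field \<Rightarrow> 'g::linordered_ab_group_add) \<Rightarrow> bool" where
  "extremal v \<longleftrightarrow>
     (\<forall>n::nat. \<forall>F::(nat \<Rightarrow>\<^sub>0 nat) \<Rightarrow>\<^sub>0 'a. n \<ge> 1 \<longrightarrow> mpoly_in_vars n F \<longrightarrow>
        (\<exists>a. (\<forall>i<n. a i \<in> val_ring v) \<and> mpoly_eval F a = 0) \<or>
        (\<exists>a. (\<forall>i<n. a i \<in> val_ring v) \<and> mpoly_eval F a \<noteq> 0 \<and>
           (\<forall>b. (\<forall>i<n. b i \<in> val_ring v) \<longrightarrow> mpoly_eval F b \<noteq> 0 \<longrightarrow>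
                 v (mpoly_eval F b) \<le> v (mpoly_eval F a))))"

definition henselian :: "('a::field \<Rightarrow> 'g::linordered_ab_group_add) \<Rightarrow> bool" where
  "henselian v \<longleftrightarrow>
     (\<forall>f::'a poly. \<forall>a. lead_coeff f = 1 \<longrightarrow> (\<forall>i. coeff f i \<in> val_ring v) \<longrightarrow>
        a \<in> val_ring v \<longrightarrow>
        (poly f a = 0 \<or> 0 < v (poly f a)) \<longrightarrow>
        (poly (pderiv f) a \<noteq> 0 \<and> v (poly (pderiv f) a) = 0) \<longrightarrow>
        (\<exists>b \<in> val_ring v. poly f b = 0 \<and> (b = a \<or> 0 < v (b - a))))"

definition field_hom :: "('a::field \<Rightarrow> 'b::field) \<Rightarrow> bool" where
  "field_hom \<iota> \<longleftrightarrow> \<iota> 1 = 1 \<and> (\<forall>x y. \<iota> (x + y) = \<iota> x + \<iota> y) \<and> (\<forall>x y. \<iota> (x * y) = \<iota> x * \<iota> y)"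

definition finite_ext :: "('a::field \<Rightarrow> 'b::field) \<Rightarrow> bool" where
  "finite_ext \<iota> \<longleftrightarrow> field_hom \<iota> \<and>
     (\<exists>B. finite B \<and> module.span (\<lambda>c y. \<iota> c * y) B = (UNIV :: 'b set))"

definition ext_degree :: "('a::field \<Rightarrow> 'b::field) \<Rightarrow> nat" where
  "ext_degree \<iota> = vector_space.dim (\<lambda>c y. \<iota> c * y) (UNIV :: 'b set)"

definition valued_finite_ext ::
  "('a::field \<Rightarrow> 'g::linordered_ab_group_add) \<Rightarrow> ('a \<Rightarrow> 'b::field) \<Rightarrow> ('b \<Rightarrow> 'g) \<Rightarrow> bool" where
  "valued_finite_ext v \<iota> w \<longleftrightarrow> finite_ext \<iota> \<and> valuation w \<and> (\<forall>x. x \<noteq> 0 \<longrightarrow> w (\<iota> x) = v x)"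

definition ram_index ::
  "('a::field \<Rightarrow> 'g::linordered_ab_group_add) \<Rightarrow> ('b::field \<Rightarrow> 'g) \<Rightarrow> nat" where
  "ram_index v w = card ((\<lambda>\<delta>. (\<lambda>\<gamma>. \<delta> + \<gamma>) ` value_group v) ` value_group w)"

text \<open>A finite set B \<subseteq> O_w whose residues form a basis of the residue field l = O_w/m_w
  over k = O_v/m_v (written out elementwise: "residually zero" means x = 0 or value > 0).\<close>
definition residually_zero :: "('a::field \<Rightarrow> 'g::linordered_ab_group_add) \<Rightarrow> 'a \<Rightarrow> bool" where
  "residually_zero v x \<longleftrightarrow> x = 0 \<or> 0 < v x"

definition residue_basis ::
  "('a::field \<Rightarrow> 'g::linordered_ab_group_add) \<Rightarrow> ('a \<Rightarrow> 'b::field) \<Rightarrow> ('b \<Rightarrow> 'g) \<Rightarrow> 'b set \<Rightarrow> bool" where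
  "residue_basis v \<iota> w B \<longleftrightarrow> finite B \<and> B \<subseteq> val_ring w \<and>
     \<comment> \<open>residues of the elements of B are distinct and k-linearly independent\<close>
     inj_on (\<lambda>b. {y \<in> val_ring w. residually_zero w (y - b)}) B \<and>
     (\<forall>c. (\<forall>b\<in>B. c b \<in> val_ring v) \<longrightarrow> residually_zero w (\<Sum>b\<in>B. \<iota> (c b) * b) \<longrightarrow>
          (\<forall>b\<in>B. residually_zero v (c b))) \<and>
     \<comment> \<open>residues of the elements of B span l over k\<close>
     (\<forall>y \<in> val_ring w. \<exists>c. (\<forall>b\<in>B. c b \<in> val_ring v) \<and>
          residually_zero w (y - (\<Sum>b\<in>B. \<iota> (c b) * b)))"

definition res_degree ::
  "('a::field \<Rightarrow> 'g::linordered_ab_group_add) \<Rightarrow> ('a \<Rightarrow> 'b::field) \<Rightarrow> ('b \<Rightarrow> 'g) \<Rightarrow> nat" where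
  "res_degree v \<iota> w = (LEAST d. \<exists>B. residue_basis v \<iota> w B \<and> card B = d)"

text \<open>Algebraic completeness, relative to extensions whose underlying type is 'b.
  (Quantification over all types of L happens at the theorem level.)\<close>
definition algebraically_complete ::
  "('a::field \<Rightarrow> 'g::linordered_ab_group_add) \<Rightarrow> 'b::field itself \<Rightarrow> bool" where
  "algebraically_complete v (_::'b itself) \<longleftrightarrow> henselian v \<and>
     (\<forall>(\<iota>::'a \<Rightarrow> 'b) (w::'b \<Rightarrow> 'g). valued_finite_ext v \<iota> w \<longrightarrow>
        ext_degree \<iota> = ram_index v w * res_degree v \<iota> w)"

end

theory Submission
  imports Defs "Jordan_Normal_Form.Determinant"
begin

text \<open>Henselianity follows from a Newton step. For a finite extension \<open>L\<close> of degree \<open>n\<close> the key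
  point is \<open>v (N y) = n w y\<close> for the norm \<open>N\<close>. If \<open>B\<close> is an order of \<open>L\<close> inside the valuation ring of
  \<open>w\<close> and \<open>b \<in> B\<close> has positive value, then \<open>1 + b B\<close> is multiplicatively closed, omits \<open>0\<close> and is
  parametrized polynomially by a power of the valuation ring of \<open>v\<close>; extremality yields a largest
  \<open>v (N s)\<close> on it, and squaring \<open>s\<close> shows that it is at most \<open>0\<close>. Applied to suitable orders this gives
  \<open>v (N y) = 0\<close> whenever \<open>w y = 0\<close>.

  Consequently every \<open>L\<close>-valued polynomial function on a power of the valuation ring of \<open>v\<close> attains a
  maximal value. Hence elements of \<open>L\<close> have best approximations in subspaces with an orthogonal basis, so
  coset representatives of the value groups times a lifted residue basis form a basis of \<open>L\<close>. If
  both value groups agree, this parametrizes the valuation ring of \<open>w\<close> by coordinates in that of \<open>v\<close>.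
  Otherwise it is cut out of a bounded set of coordinates by \<open>v (N y) \<ge> 0\<close>, and this constraint is
  imposed by a penalty term with a value outside the value group of \<open>K\<close>.\<close>

section \<open>Polynomial functions and valued fields\<close>

text \<open>The norm turns an \<open>L\<close>-valued function into a \<open>K\<close>-valued
  polynomial function, to which extremality of \<open>v\<close> applies;
  \<open>v (N y) = n w y\<close> says that the order of the values survives. If \<open>m\<close> is
  the largest value on \<open>1 + b B\<close>, squaring gives \<open>2 m \<le> m\<close>. For
  \<open>u\<close> in \<open>B\<close> of value 0, a relation for \<open>u\<close> produces
  \<open>z\<close> in \<open>B\<close> with \<open>u z\<close> in \<open>1 + b B\<close>, so the
  bound passes to \<open>N u\<close>. The obstacle is an element \<open>y\<close> of value 0 in no
  evident order: a relation for \<open>y\<close> can be made primitive, but its leading coefficient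
  need not be invertible, so the powers of \<open>y\<close> are replaced by auxiliary elements
  \<open>h\<close> for which \<open>h\<close> and \<open>y h\<close> lie in a common order. Other
  values reduce to value 0 because the value group of \<open>w\<close> is torsion modulo that of
  \<open>v\<close>. In the last step, the coordinates of the valuation ring of \<open>w\<close>
  along a basis vector \<open>d\<close> satisfy \<open>v c \<ge> - w d\<close>; if
  \<open>w d\<close> is outside the value group of \<open>K\<close>, these \<open>c\<close> need not
  form a multiple of the valuation ring of \<open>v\<close>, so rescaling cannot parametrize
  them.\<close>

text \<open>Used with \<open>\<phi>\<close> the identity for \<open>K\<close>-valued functions and
  with \<open>\<phi> = \<iota>\<close> for \<open>L\<close>-valued functions of variables in
  \<open>K\<close>. Arbitrary index types let basis vectors, pairs or constraints label the
  variables.\<close>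

inductive_set polyfun :: "('a \<Rightarrow> 'b::comm_ring_1) \<Rightarrow> 'i set \<Rightarrow> (('i \<Rightarrow> 'a) \<Rightarrow> 'b) set"
  for \<phi> I where
    const: "(\<lambda>_. c) \<in> polyfun \<phi> I"
  | var: "i \<in> I \<Longrightarrow> (\<lambda>a. \<phi> (a i)) \<in> polyfun \<phi> I"
  | add: "p \<in> polyfun \<phi> I \<Longrightarrow> q \<in> polyfun \<phi> I \<Longrightarrow> (\<lambda>a. p a + q a) \<in> polyfun \<phi> I"
  | mult: "p \<in> polyfun \<phi> I \<Longrightarrow> q \<in> polyfun \<phi> I \<Longrightarrow> (\<lambda>a. p a * q a) \<in> polyfun \<phi> I"

lemma polyfun_diff:
  assumes "p \<in> polyfun \<phi> I" "q \<in> polyfun \<phi> I"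
  shows "(\<lambda>a. p a - q a) \<in> polyfun \<phi> I"
  using polyfun.add[OF assms(1) polyfun.mult[OF polyfun.const[of "-1"] assms(2)]] by simp

lemma polyfun_sum:
  assumes "\<And>k. k \<in> S \<Longrightarrow> p k \<in> polyfun \<phi> I"
  shows "(\<lambda>a. \<Sum>k\<in>S. p k a) \<in> polyfun \<phi> I"
  using assms
  by (induction S rule: infinite_finite_induct) (auto intro: polyfun.intros)

lemma polyfun_prod:
  assumes "\<And>k. k \<in> S \<Longrightarrow> p k \<in> polyfun \<phi> I"
  shows "(\<lambda>a. \<Prod>k\<in>S. p k a) \<in> polyfun \<phi> I"
  using assms
  by (induction S rule: infinite_finite_induct) (auto intro: polyfun.intros)

lemma polyfun_power:
  "p \<in> polyfun \<phi> I \<Longrightarrow> (\<lambda>a. p a ^ k) \<in> polyfun \<phi> I"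
  by (induction k) (auto intro: polyfun.intros)

lemma polyfun_mono: "p \<in> polyfun \<phi> I \<Longrightarrow> I \<subseteq> J \<Longrightarrow> p \<in> polyfun \<phi> J"
  by (induction rule: polyfun.induct) (auto intro: polyfun.intros)

lemma polyfun_cong: "p \<in> polyfun \<phi> I \<Longrightarrow> (\<And>i. i \<in> I \<Longrightarrow> a i = b i) \<Longrightarrow> p a = p b"
  by (induction rule: polyfun.induct) auto

lemma polyfun_reindex:
  "p \<in> polyfun \<phi> I \<Longrightarrow> (\<lambda>a. p (\<lambda>i. a (f i))) \<in> polyfun \<phi> (f ` I)"
  by (induction rule: polyfun.induct) (auto intro: polyfun.intros)

lemma polyfun_mpoly_eval:
  assumes "mpoly_in_vars n F" "\<And>i. i < n \<Longrightarrow> q i \<in> polyfun \<phi> J"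
  shows "(\<lambda>a. mpoly_eval F (\<lambda>i. q i a)) \<in> polyfun \<phi> J"
  unfolding mpoly_eval_def
  using assms unfolding mpoly_in_vars_def
  by (intro polyfun_sum polyfun.mult polyfun_prod polyfun_power polyfun.const) blast

section \<open>Formal polynomials realizing polynomial functions\<close>

text \<open>Keys may cancel in a sum, so evaluations are compared over a common superset of
  keys.\<close>

lemma mpoly_eval_superset:
  assumes "finite S" "Poly_Mapping.keys F \<subseteq> S"
  shows "mpoly_eval F a = (\<Sum>m\<in>S. Poly_Mapping.lookup F m *
    (\<Prod>i \<in> Poly_Mapping.keys m. a i ^ Poly_Mapping.lookup m i))"
  unfolding mpoly_eval_def using assms
  by (intro sum.mono_neutral_left) (auto simp: in_keys_iff)

lemma mpoly_eval_add: "mpoly_eval (F + G) a = mpoly_eval F a + mpoly_eval G a"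
proof -
  let ?S = "Poly_Mapping.keys F \<union> Poly_Mapping.keys G"
  have "finite ?S" by simp
  then show ?thesis
    using mpoly_eval_superset[of ?S F a] mpoly_eval_superset[of ?S G a]
      mpoly_eval_superset[OF _ Poly_Mapping.keys_add, of F G a]
    by (simp add: lookup_add sum.distrib algebra_simps)
qed

lemma mpoly_eval_single:
  "mpoly_eval (Poly_Mapping.single m c) a =
    c * (\<Prod>i \<in> Poly_Mapping.keys m. a i ^ Poly_Mapping.lookup m i)"
  by (simp add: mpoly_eval_def)

definition mpoly_fun :: "nat \<Rightarrow> ((nat \<Rightarrow> 'a::comm_ring_1) \<Rightarrow> 'a) \<Rightarrow> bool" where
  "mpoly_fun n p \<longleftrightarrow> (\<exists>F. mpoly_in_vars n F \<and> (\<forall>a. mpoly_eval F a = p a))"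

lemma mpoly_fun_add:
  assumes "mpoly_fun n p" "mpoly_fun n q"
  shows "mpoly_fun n (\<lambda>a. p a + q a)"
proof -
  obtain F G where F: "mpoly_in_vars n F" "\<forall>a. mpoly_eval F a = p a"
    and G: "mpoly_in_vars n G" "\<forall>a. mpoly_eval G a = q a"
    using assms unfolding mpoly_fun_def by blast
  have "mpoly_in_vars n (F + G)"
    using F(1) G(1) Poly_Mapping.keys_add[of F G] unfolding mpoly_in_vars_def by (meson Un_iff subsetD)
  then show ?thesis
    unfolding mpoly_fun_def using F(2) G(2) by (intro exI[of _ "F + G"]) (simp add: mpoly_eval_add)
qed

lemma mpoly_fun_sum:
  assumes "\<And>k. k \<in> S \<Longrightarrow> mpoly_fun n (p k)"
  shows "mpoly_fun n (\<lambda>a. \<Sum>k\<in>S. p k a)"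
proof -
  have "mpoly_fun n (\<lambda>_. 0)"
    unfolding mpoly_fun_def by (intro exI[of _ 0]) (simp add: mpoly_in_vars_def mpoly_eval_def)
  then show ?thesis
    using assms by (induction S rule: infinite_finite_induct) (auto intro: mpoly_fun_add)
qed

lemma mpoly_fun_monom:
  assumes "Poly_Mapping.keys m \<subseteq> {..<n}"
  shows "mpoly_fun n (\<lambda>a. c * (\<Prod>i \<in> Poly_Mapping.keys m. a i ^ Poly_Mapping.lookup m i))"
  unfolding mpoly_fun_def using assms
  by (intro exI[of _ "Poly_Mapping.single m c"]) (auto simp: mpoly_eval_single mpoly_in_vars_def)

lemma prod_monom_superset:
  fixes a :: "nat \<Rightarrow> 'a::comm_ring_1"
  assumes "finite S" "Poly_Mapping.keys m \<subseteq> S"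
  shows "(\<Prod>i \<in> Poly_Mapping.keys m. a i ^ Poly_Mapping.lookup m i) =
    (\<Prod>i \<in> S. a i ^ Poly_Mapping.lookup m i)"
  using assms by (intro prod.mono_neutral_left) (auto simp: in_keys_iff)

lemma mpoly_fun_mult:
  assumes "mpoly_fun n p" "mpoly_fun n q"
  shows "mpoly_fun n (\<lambda>a. p a * q a)"
proof -
  obtain F G where F: "mpoly_in_vars n F" "\<And>a. mpoly_eval F a = p a"
    and G: "mpoly_in_vars n G" "\<And>a. mpoly_eval G a = q a"
    using assms unfolding mpoly_fun_def by blast
  let ?mon = "\<lambda>m a. \<Prod>i \<in> Poly_Mapping.keys m. a i ^ Poly_Mapping.lookup m i"
  have mon: "?mon (m + m') a = ?mon m a * ?mon m' a" for m m' and a :: "nat \<Rightarrow> 'a"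
  proof -
    let ?S = "Poly_Mapping.keys m \<union> Poly_Mapping.keys m'"
    have "finite ?S" by simp
    then show ?thesis
      using prod_monom_superset[of ?S m a] prod_monom_superset[of ?S m' a]
        prod_monom_superset[OF _ Poly_Mapping.keys_add, of m m' a]
      by (simp add: lookup_add power_add prod.distrib)
  qed
  have "(\<lambda>a. p a * q a) = (\<lambda>a. \<Sum>m\<in>Poly_Mapping.keys F. \<Sum>m'\<in>Poly_Mapping.keys G.
      (Poly_Mapping.lookup F m * Poly_Mapping.lookup G m') * ?mon (m + m') a)"
    unfolding F(2)[symmetric] G(2)[symmetric] mpoly_eval_def mon sum_product
    by (simp add: algebra_simps)
  moreover have "mpoly_fun n \<dots>"
  proof (intro mpoly_fun_sum mpoly_fun_monom)
    fix m m' assume "m \<in> Poly_Mapping.keys F" "m' \<in> Poly_Mapping.keys G"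
    then show "Poly_Mapping.keys (m + m') \<subseteq> {..<n}"
      using F(1) G(1) Poly_Mapping.keys_add[of m m'] unfolding mpoly_in_vars_def by blast
  qed
  ultimately show ?thesis by simp
qed

text \<open>Lets \<open>extremal\<close>, which speaks of formal polynomials, be applied to
  functions built by the rules of \<open>polyfun\<close>.\<close>

lemma mpoly_fun_polyfun:
  fixes p :: "(nat \<Rightarrow> 'a::comm_ring_1) \<Rightarrow> 'a"
  assumes "p \<in> polyfun (\<lambda>x. x) {..<n}"
  shows "mpoly_fun n p"
  using assms
proof induction
  case (const c)
  show ?case using mpoly_fun_monom[of 0 n c] by simp
next
  case (var i)
  then show ?case using mpoly_fun_monom[of "Poly_Mapping.single i 1" n 1] by simp
qed (auto intro: mpoly_fun_add mpoly_fun_mult)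

section \<open>Valuations, with 0 as the element of largest value\<close>

locale valued =
  fixes v :: "'a::field \<Rightarrow> 'g::linordered_ab_group_add"
  assumes valuation: "valuation v"
begin

text \<open>The order \<open>v x \<le> v y\<close> of extended values, with \<open>v 0 = \<infinity>\<close>.\<close>

definition vle :: "'a \<Rightarrow> 'a \<Rightarrow> bool" where
  "vle x y \<longleftrightarrow> y = 0 \<or> (x \<noteq> 0 \<and> v x \<le> v y)"

text \<open>Thus \<open>vle 1 x\<close> is membership in the valuation ring, \<open>vlt 1 x\<close>
  membership in its maximal ideal, and \<open>vle x 1\<close> includes
  \<open>x \<noteq> 0\<close>.\<close>

abbreviation vlt :: "'a \<Rightarrow> 'a \<Rightarrow> bool" where
  "vlt x y \<equiv> \<not> vle y x"

lemma val_mult: "x \<noteq> 0 \<Longrightarrow> y \<noteq> 0 \<Longrightarrow> v (x * y) = v x + v y"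
  using valuation unfolding valuation_def by blast

lemma val_add: "x \<noteq> 0 \<Longrightarrow> y \<noteq> 0 \<Longrightarrow> x + y \<noteq> 0 \<Longrightarrow> min (v x) (v y) \<le> v (x + y)"
  using valuation unfolding valuation_def by blast

lemma val_one [simp]: "v 1 = 0"
  using val_mult[of 1 1] by simp

lemma val_uminus [simp]: "v (- x) = v x"
proof (cases "x = 0")
  case False
  have "v (-1) + v (-1) = 0"
    using val_mult[of "-1" "-1"] by simp
  then have "v (-1) = 0" by simp
  then show ?thesis using False val_mult[of "-1" x] by simp
qed simp

lemma val_inverse: "x \<noteq> 0 \<Longrightarrow> v (inverse x) = - v x"
  using val_mult[of x "inverse x"] by (simp add: eq_neg_iff_add_eq_0 add.commute)

lemma val_divide: "x \<noteq> 0 \<Longrightarrow> y \<noteq> 0 \<Longrightarrow> v (x / y) = v x - v y"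
  by (simp add: divide_inverse val_mult val_inverse)

lemma vle_refl [simp]: "vle x x"
  by (simp add: vle_def)

lemma vle_trans [trans]: "vle x y \<Longrightarrow> vle y z \<Longrightarrow> vle x z"
  by (auto simp: vle_def)

lemma vle_total: "vle x y \<or> vle y x"
  by (auto simp: vle_def)

lemma vlt_imp_vle: "vlt x y \<Longrightarrow> vle x y"
  using vle_total by blast

lemma vle_zero [simp]: "vle x 0"
  by (simp add: vle_def)

lemma zero_vle_iff [simp]: "vle 0 x \<longleftrightarrow> x = 0"
  by (auto simp: vle_def)

lemma vle_uminus [simp]: "vle x (- y) \<longleftrightarrow> vle x y" "vle (- x) y \<longleftrightarrow> vle x y"
  by (auto simp: vle_def)

lemma vle_add: "vle x y \<Longrightarrow> vle x z \<Longrightarrow> vle x (y + z)"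
  using val_add[of y z]
  by (cases "y = 0"; cases "z = 0"; cases "y + z = 0") (auto simp: vle_def min_le_iff_disj)

lemma vle_diff: "vle x y \<Longrightarrow> vle x z \<Longrightarrow> vle x (y - z)"
  using vle_add[of x y "- z"] by simp

lemma vle_sum: "(\<And>i. i \<in> I \<Longrightarrow> vle x (f i)) \<Longrightarrow> vle x (sum f I)"
  by (induction I rule: infinite_finite_induct) (auto intro: vle_add)

lemma vle_mult_right: "vle x y \<Longrightarrow> vle (x * z) (y * z)"
  by (auto simp: vle_def val_mult)

lemma vle_mult_left: "vle x y \<Longrightarrow> vle (z * x) (z * y)"
  using vle_mult_right[of x y z] by (simp add: mult.commute)

lemma vle_mult: "vle x y \<Longrightarrow> vle z u \<Longrightarrow> vle (x * z) (y * u)"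
  using vle_mult_right[of x y z] vle_mult_left[of z u y] vle_trans by blast

lemma vle_mult_right_cancel: "z \<noteq> 0 \<Longrightarrow> vle (x * z) (y * z) \<longleftrightarrow> vle x y"
  using vle_mult_right[of "x * z" "y * z" "inverse z"] vle_mult_right[of x y z]
  by (auto simp: mult.assoc)

lemma vle_mult_left_cancel: "z \<noteq> 0 \<Longrightarrow> vle (z * x) (z * y) \<longleftrightarrow> vle x y"
  using vle_mult_right_cancel[of z x y] by (simp add: mult.commute)

lemma vle_power: "vle x y \<Longrightarrow> vle (x ^ k) (y ^ k)"
  by (induction k) (auto intro: vle_mult)

lemma vlt_mult: "vlt x y \<Longrightarrow> vle z u \<Longrightarrow> z \<noteq> 0 \<Longrightarrow> vlt (x * z) (y * u)"
  using vle_mult_right_cancel[of z y x] vle_mult_left[of z u y] vle_trans by blast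

lemma vlt_power: "vlt x y \<Longrightarrow> 0 < k \<Longrightarrow> vlt (x ^ k) (y ^ k)"
proof (induction k)
  case (Suc k)
  have "x \<noteq> 0" using Suc.prems by auto
  then have "x ^ k \<noteq> 0" by simp
  then show ?case
    using vlt_mult[OF Suc.prems(1) vle_power[OF vlt_imp_vle[OF Suc.prems(1)], of k]] by simp
qed simp

lemma vle_power_iff: "0 < k \<Longrightarrow> vle (x ^ k) (y ^ k) \<longleftrightarrow> vle x y"
  using vle_power vlt_power by blast

lemma vlt_add: "vlt x y \<Longrightarrow> vlt x z \<Longrightarrow> vlt x (y + z)"
  using vle_add[of y y z] vle_add[of z y z] vle_total[of y z] vle_trans vle_refl by metis

lemma vlt_sum: "x \<noteq> 0 \<Longrightarrow> (\<And>i. i \<in> I \<Longrightarrow> vlt x (f i)) \<Longrightarrow> vlt x (sum f I)"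
  by (induction I rule: infinite_finite_induct) (simp_all add: vlt_add)

lemma vle_add_vlt: "vlt x y \<Longrightarrow> vle (x + y) x"
  using vlt_add[where x = "x + y" and y = x and z = "- y"] vlt_add[where x = x and y = "x + y" and z = "- y"] by auto

lemma vle_add_vlt': "vlt x y \<Longrightarrow> vle x (x + y)"
  using vlt_imp_vle[of x y] by (intro vle_add) auto

lemma in_val_ring_iff: "x \<in> val_ring v \<longleftrightarrow> vle 1 x"
  by (auto simp: val_ring_def vle_def)

lemma residually_zero_iff: "residually_zero v x \<longleftrightarrow> vlt 1 x"
  by (auto simp: residually_zero_def vle_def)

lemma val_eq_iff: "x \<noteq> 0 \<Longrightarrow> y \<noteq> 0 \<Longrightarrow> v x = v y \<longleftrightarrow> vle x y \<and> vle y x"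
  by (auto simp: vle_def)

lemma vle_divide_iff: "x \<noteq> 0 \<Longrightarrow> vle 1 (y / x) \<longleftrightarrow> vle x y"
  using vle_mult_right_cancel[of x 1 "y / x"] by simp

lemma val_ring_0 [simp]: "0 \<in> val_ring v" and val_ring_1 [simp]: "1 \<in> val_ring v"
  by (auto simp: in_val_ring_iff)

lemma val_ring_add: "x \<in> val_ring v \<Longrightarrow> y \<in> val_ring v \<Longrightarrow> x + y \<in> val_ring v"
  by (auto simp: in_val_ring_iff intro: vle_add)

lemma val_ring_uminus [simp]: "- x \<in> val_ring v \<longleftrightarrow> x \<in> val_ring v"
  by (auto simp: in_val_ring_iff)

lemma val_ring_mult: "x \<in> val_ring v \<Longrightarrow> y \<in> val_ring v \<Longrightarrow> x * y \<in> val_ring v"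
  using vle_mult[of 1 x 1 y] by (auto simp: in_val_ring_iff)

lemma val_ring_sum: "(\<And>i. i \<in> I \<Longrightarrow> f i \<in> val_ring v) \<Longrightarrow> sum f I \<in> val_ring v"
  by (auto simp: in_val_ring_iff intro: vle_sum)

lemma val_ring_prod: "(\<And>i. i \<in> I \<Longrightarrow> f i \<in> val_ring v) \<Longrightarrow> prod f I \<in> val_ring v"
  by (induction I rule: infinite_finite_induct) (auto intro: val_ring_mult)

lemma val_ring_power: "x \<in> val_ring v \<Longrightarrow> x ^ k \<in> val_ring v"
  by (induction k) (auto intro: val_ring_mult)

lemma exists_vle_min:
  assumes "finite I" "I \<noteq> {}"
  obtains i where "i \<in> I" "\<And>j. j \<in> I \<Longrightarrow> vle (f i) (f j)"
  using assms
proof (induction I arbitrary: thesis rule: finite_ne_induct)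
  case (insert x F)
  obtain i where "i \<in> F" "\<And>j. j \<in> F \<Longrightarrow> vle (f i) (f j)"
    using insert.IH by blast
  then show ?case
    using insert.prems[of i] insert.prems[of x] vle_total[of "f i" "f x"] vle_trans
    by (metis insert_iff vle_refl)
qed auto

end

section \<open>Extremality as a maximum principle\<close>

text \<open>A zero of the polynomial is a point of largest value once \<open>0\<close> is the top of
  \<open>vle\<close>; this merges the two cases of \<open>extremal\<close>.\<close>

lemma extremal_iff_vle:
  assumes "valuation v"
  shows "extremal v \<longleftrightarrow> (\<forall>n F. n \<ge> 1 \<longrightarrow> mpoly_in_vars n F \<longrightarrow>
    (\<exists>a. (\<forall>i<n. a i \<in> val_ring v) \<and>
      (\<forall>b. (\<forall>i<n. b i \<in> val_ring v) \<longrightarrow> valued.vle v (mpoly_eval F b) (mpoly_eval F a))))"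
proof -
  interpret valued v by unfold_locales fact
  have "(\<exists>a. (\<forall>i<n. a i \<in> val_ring v) \<and>
      (\<forall>b. (\<forall>i<n. b i \<in> val_ring v) \<longrightarrow> vle (mpoly_eval F b) (mpoly_eval F a))) \<longleftrightarrow>
      (\<exists>a. (\<forall>i<n. a i \<in> val_ring v) \<and> mpoly_eval F a = 0) \<or>
        (\<exists>a. (\<forall>i<n. a i \<in> val_ring v) \<and> mpoly_eval F a \<noteq> 0 \<and>
           (\<forall>b. (\<forall>i<n. b i \<in> val_ring v) \<longrightarrow> mpoly_eval F b \<noteq> 0 \<longrightarrow>
                 v (mpoly_eval F b) \<le> v (mpoly_eval F a)))"
    (is "?L \<longleftrightarrow> ?R") for n F
  proof
    assume ?L
    then obtain a where a: "\<forall>i<n. a i \<in> val_ring v"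
      "\<And>b. \<forall>i<n. b i \<in> val_ring v \<Longrightarrow> vle (mpoly_eval F b) (mpoly_eval F a)" by blast
    show ?R
    proof (cases "mpoly_eval F a = 0")
      case False
      with a(2) have "\<forall>b. (\<forall>i<n. b i \<in> val_ring v) \<longrightarrow> mpoly_eval F b \<noteq> 0 \<longrightarrow>
          v (mpoly_eval F b) \<le> v (mpoly_eval F a)"
        unfolding vle_def by simp
      with a(1) False show ?thesis by (intro disjI2 exI[of _ a]) simp
    qed (use a(1) in blast)
  next
    assume R: ?R
    show ?L
    proof (cases "\<exists>a. (\<forall>i<n. a i \<in> val_ring v) \<and> mpoly_eval F a = 0")
      case True
      then obtain a where "\<forall>i<n. a i \<in> val_ring v" "mpoly_eval F a = 0" by blast
      then show ?thesis by (intro exI[of _ a]) simp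
    next
      case False
      with R obtain a where "\<forall>i<n. a i \<in> val_ring v" and "\<forall>b. (\<forall>i<n. b i \<in> val_ring v) \<longrightarrow>
          mpoly_eval F b \<noteq> 0 \<longrightarrow> v (mpoly_eval F b) \<le> v (mpoly_eval F a)" by blast
      with False have "(\<forall>i<n. a i \<in> val_ring v) \<and> (\<forall>b. (\<forall>i<n. b i \<in> val_ring v) \<longrightarrow>
          vle (mpoly_eval F b) (mpoly_eval F a))"
        unfolding vle_def by (intro conjI allI impI disjI2) blast+
      then show ?thesis by blast
    qed
  qed
  then show ?thesis unfolding extremal_def by simp
qed

locale extremal_valued = valued +
  assumes extremal: "extremal v"
begin

lemma polyfun_max:
  assumes "finite I" and p: "p \<in> polyfun (\<lambda>x. x) I"
  obtains a where "\<And>i. i \<in> I \<Longrightarrow> a i \<in> val_ring v"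
    "\<And>b. (\<And>i. i \<in> I \<Longrightarrow> b i \<in> val_ring v) \<Longrightarrow> vle (p b) (p a)"
proof -
  \<comment> \<open>\<open>Suc\<close> because \<open>extremal\<close> asks for at least one
    variable; the extra one is a dummy.\<close>
  define n where "n = Suc (card I)"
  obtain f where f: "bij_betw f I {0..<card I}"
    using ex_bij_betw_finite_nat[OF assms(1)] by blast
  then have inj: "inj_on f I" and im: "f ` I \<subseteq> {..<n}"
    by (auto simp: bij_betw_def n_def)
  have "(\<lambda>a. p (\<lambda>i. a (f i))) \<in> polyfun (\<lambda>x. x) {..<n}"
    using polyfun_mono[OF polyfun_reindex[OF p] im] .
  then obtain F where F: "mpoly_in_vars n F" "\<And>a. mpoly_eval F a = p (\<lambda>i. a (f i))"
    using mpoly_fun_polyfun unfolding mpoly_fun_def by blast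
  obtain a where a: "\<forall>i<n. a i \<in> val_ring v"
    "\<And>b. (\<forall>i<n. b i \<in> val_ring v) \<Longrightarrow> vle (mpoly_eval F b) (mpoly_eval F a)"
    using extremal F(1) unfolding extremal_iff_vle[OF valuation] n_def by (metis le_add1 plus_1_eq_Suc)
  show ?thesis
  proof (rule that)
    show "a (f i) \<in> val_ring v" if "i \<in> I" for i using a(1) im that by blast
    fix b :: "_ \<Rightarrow> 'a" assume b: "\<And>i. i \<in> I \<Longrightarrow> b i \<in> val_ring v"
    define b' where "b' k = (if k \<in> f ` I then b (the_inv_into I f k) else 0)" for k
    have "b' (f i) = b i" if "i \<in> I" for i
      using that inj by (simp add: b'_def the_inv_into_f_f)
    then have "p b = mpoly_eval F b'"
      unfolding F(2) by (intro polyfun_cong[OF p]) simp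
    moreover have "\<forall>i<n. b' i \<in> val_ring v"
      unfolding b'_def using b inj by (auto simp: the_inv_into_f_f)
    ultimately show "vle (p b) (p (\<lambda>i. a (f i)))"
      using a(2) F(2) by metis
  qed
qed

end

section \<open>Newton steps and henselianity\<close>

lemma polyfun_poly:
  assumes "q \<in> polyfun \<phi> I"
  shows "(\<lambda>a. poly f (q a)) \<in> polyfun \<phi> I"
  by (induction f) (simp_all add: assms polyfun.intros)

context valued
begin

lemma val_ring_of_nat: "of_nat k \<in> val_ring v"
  by (induction k) (auto intro: val_ring_add)

lemma val_ring_coeff_pderiv:
  "\<forall>i. coeff f i \<in> val_ring v \<Longrightarrow> \<forall>i. coeff (pderiv f) i \<in> val_ring v"
  unfolding coeff_pderiv by (intro allI val_ring_mult val_ring_of_nat) blast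

lemma poly_in_val_ring:
  "\<forall>i. coeff f i \<in> val_ring v \<Longrightarrow> x \<in> val_ring v \<Longrightarrow> poly f x \<in> val_ring v"
  unfolding poly_altdef by (intro val_ring_sum val_ring_mult val_ring_power) auto

text \<open>Induction on the coefficients yields an integral remainder directly; halving a second
  derivative would fail in characteristic 2.\<close>

lemma poly_taylor2:
  assumes "\<forall>i. coeff f i \<in> val_ring v" "b \<in> val_ring v" "t \<in> val_ring v"
  shows "\<exists>r\<in>val_ring v. poly f (b + t) = poly f b + poly (pderiv f) b * t + t\<^sup>2 * r"
  using assms(1)
proof (induction f)
  case 0
  show ?case by (intro bexI[of _ 0]) simp_all
next
  case (pCons c f)
  from pCons.prems have f: "\<forall>i. coeff f i \<in> val_ring v"
    by (metis coeff_pCons_Suc)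
  with pCons.IH obtain r where r: "r \<in> val_ring v"
    "poly f (b + t) = poly f b + poly (pderiv f) b * t + t\<^sup>2 * r" by blast
  show ?case
  proof (rule bexI)
    show "poly (pCons c f) (b + t) = poly (pCons c f) b + poly (pderiv (pCons c f)) b * t +
        t\<^sup>2 * (poly (pderiv f) b + (b + t) * r)"
      by (simp add: r(2) pderiv_pCons algebra_simps power2_eq_square)
    show "poly (pderiv f) b + (b + t) * r \<in> val_ring v"
      by (intro val_ring_add val_ring_mult poly_in_val_ring val_ring_coeff_pderiv f assms r)
  qed
qed

end

context extremal_valued
begin

text \<open>A maximum \<open>b\<close> of \<open>v \<circ> f\<close> on the ball \<open>a + f(a) O\<close> must be a root, since the Newton step
  from \<open>b\<close> stays in the ball and increases the value.\<close>

lemma henselian: "henselian v"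
  unfolding henselian_def
proof (intro allI impI)
  fix f :: "'a poly" and a
  assume O: "\<forall>i. coeff f i \<in> val_ring v" and a: "a \<in> val_ring v"
    and fa: "poly f a = 0 \<or> 0 < v (poly f a)"
    and f'a: "poly (pderiv f) a \<noteq> 0 \<and> v (poly (pderiv f) a) = 0"
  define c where "c = poly f a"
  have c: "vlt 1 c"
    using fa unfolding c_def residually_zero_iff[symmetric] residually_zero_def by blast
  then have cO: "c \<in> val_ring v" by (simp add: in_val_ring_iff vlt_imp_vle)
  have f'a1: "vle (poly (pderiv f) a) 1" using f'a by (simp add: vle_def)
  show "\<exists>b\<in>val_ring v. poly f b = 0 \<and> (b = a \<or> 0 < v (b - a))"
  proof (cases "c = 0")
    case True
    then show ?thesis using a by (auto simp: c_def)
  next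
    case False
    \<comment> \<open>One variable, indexed by the unit type: \<open>a + c y\<close> runs through
      the ball.\<close>
    have p: "(\<lambda>y. poly f (a + c * y ())) \<in> polyfun (\<lambda>x. x) UNIV"
      by (intro polyfun_poly polyfun.intros UNIV_I)
    obtain y where y: "y () \<in> val_ring v" and max':
      "\<And>z. (\<And>i. z i \<in> val_ring v) \<Longrightarrow> vle (poly f (a + c * z ())) (poly f (a + c * y ()))"
      using polyfun_max[OF _ p] by auto
    have max: "vle (poly f (a + c * z)) (poly f (a + c * y ()))" if "z \<in> val_ring v" for z
      using max'[of "\<lambda>_. z"] that by simp
    define t where "t = c * y ()"
    have t: "vlt 1 t" using vlt_mult[OF c, of 1 "y ()"] y by (simp add: t_def in_val_ring_iff)
    have tO: "t \<in> val_ring v" by (simp add: in_val_ring_iff vlt_imp_vle t)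
    obtain r where r: "r \<in> val_ring v" "poly f (a + t) = c + poly (pderiv f) a * t + t\<^sup>2 * r"
      using poly_taylor2[OF O a tO] unfolding c_def by blast
    define s where "s = 1 + poly (pderiv f) a * y () + t * y () * r"
    have s: "poly f (a + t) = c * s"
      unfolding r(2) s_def by (simp add: t_def algebra_simps power2_eq_square)
    have sO: "s \<in> val_ring v" unfolding s_def
      by (intro val_ring_add val_ring_mult val_ring_1 poly_in_val_ring val_ring_coeff_pderiv O a y tO r)
    obtain r' where r': "r' \<in> val_ring v" "poly (pderiv f) (a + t) =
        poly (pderiv f) a + poly (pderiv (pderiv f)) a * t + t\<^sup>2 * r'"
      using poly_taylor2[OF val_ring_coeff_pderiv[OF O] a tO] by blast
    \<comment> \<open>The derivative changes from \<open>a\<close> to \<open>a + t\<close> only by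
      an element of positive value, so its value stays at most 0.\<close>
    have "poly (pderiv f) (a + t) = poly (pderiv f) a + t * (poly (pderiv (pderiv f)) a + t * r')"
      by (simp add: r'(2) algebra_simps power2_eq_square)
    moreover have "poly (pderiv (pderiv f)) a + t * r' \<in> val_ring v"
      by (intro val_ring_add val_ring_mult poly_in_val_ring val_ring_coeff_pderiv O a tO r')
    then have "vlt 1 (t * (poly (pderiv (pderiv f)) a + t * r'))"
      using vlt_mult[OF t, of 1] by (simp add: in_val_ring_iff)
    ultimately have f'b: "vle (poly (pderiv f) (a + t)) 1"
      using vle_add_vlt f'a1 vle_trans by metis
    have root: "poly f (a + t) = 0"
    proof (rule ccontr)
      assume nz: "poly f (a + t) \<noteq> 0"
      define d where "d = poly (pderiv f) (a + t)"
      have d: "d \<noteq> 0" "vle d 1" using f'b by (auto simp: d_def)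
      \<comment> \<open>The Newton step \<open>u = - f(a + t) / f'(a + t)\<close> equals
        \<open>c * s2\<close>, hence stays in the ball.\<close>
      define s2 where "s2 = - s / d"
      have s2: "s2 \<in> val_ring v"
        using sO vle_divide_iff[of d "- s"] d vle_trans
        by (auto simp: s2_def in_val_ring_iff)
      define u where "u = c * s2"
      have u: "vlt 1 u" using vlt_mult[OF c, of 1 s2] s2 by (simp add: u_def in_val_ring_iff)
      have uO: "u \<in> val_ring v" by (simp add: in_val_ring_iff vlt_imp_vle u)
      have ud: "poly f (a + t) = - (u * d)" using d by (simp add: u_def s2_def s)
      obtain r where r: "r \<in> val_ring v"
        "poly f (a + t + u) = poly f (a + t) + d * u + u\<^sup>2 * r"
        using poly_taylor2[OF O val_ring_add[OF a tO] uO] unfolding d_def by blast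
      have "a + c * (y () + s2) = a + t + u" by (simp add: t_def u_def algebra_simps)
      \<comment> \<open>The linear term cancels \<open>f(a + t)\<close>. Maximality of
        \<open>a + t\<close> now forces \<open>v (u r) \<le> v d \<le> 0\<close>, although
        \<open>u\<close> has positive value and \<open>r\<close> is integral.\<close>
      then have "poly f (a + c * (y () + s2)) = u * (u * r)"
        using r(2) by (simp only:) (simp add: ud power2_eq_square)
      then have "vle (u * (u * r)) (u * d)"
        using max[OF val_ring_add[OF y s2]] ud by (simp add: t_def)
      then have "vle (u * r) d" using vle_mult_left_cancel nz ud by auto
      then have "vle (u * r) 1" using d vle_trans by blast
      moreover have "vlt 1 (u * r)" using vlt_mult[OF u, of 1 r] r by (simp add: in_val_ring_iff)
      ultimately show False by blast
    qed
    have "t = 0 \<or> 0 < v t"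
      using t unfolding residually_zero_iff[symmetric] residually_zero_def by blast
    then show ?thesis using root val_ring_add[OF a tO] by (intro bexI[of _ "a + t"]) auto
  qed
qed

end

section \<open>The norm of a finite extension\<close>

locale finite_extension =
  fixes \<iota> :: "'a::field \<Rightarrow> 'b::field"
  assumes finite_ext: "finite_ext \<iota>"
begin

lemma hom_one [simp]: "\<iota> 1 = 1"
  and hom_add: "\<iota> (x + y) = \<iota> x + \<iota> y"
  and hom_mult: "\<iota> (x * y) = \<iota> x * \<iota> y"
  using finite_ext unfolding finite_ext_def Defs.field_hom_def by simp_all

lemma hom_zero [simp]: "\<iota> 0 = 0"
  using hom_add[of 0 0] by (metis add.right_neutral add_left_cancel)

lemma hom_uminus [simp]: "\<iota> (- x) = - \<iota> x"
  using hom_add[of x "- x"] by (simp add: eq_neg_iff_add_eq_0 add.commute)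

lemma hom_diff: "\<iota> (x - y) = \<iota> x - \<iota> y"
  using hom_add[of x "- y"] by simp

lemma hom_eq_0_iff [simp]: "\<iota> x = 0 \<longleftrightarrow> x = 0"
  using hom_mult[of x "inverse x"] by (cases "x = 0") auto

lemma hom_inverse: "\<iota> (inverse x) = inverse (\<iota> x)"
  using hom_mult[of x "inverse x"] by (cases "x = 0") (auto simp: inverse_unique)

lemma hom_divide: "\<iota> (x / y) = \<iota> x / \<iota> y"
  by (simp add: divide_inverse hom_mult hom_inverse)

lemma hom_power: "\<iota> (x ^ k) = \<iota> x ^ k"
  by (induction k) (auto simp: hom_mult)

sublocale vs: vector_space "\<lambda>c y. \<iota> c * y"
  by unfold_locales (auto simp: hom_add hom_mult algebra_simps)

declare vs.scale_scale [simp del]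

definition deg :: nat where "deg = vs.dim UNIV"

lemma deg_eq: "deg = ext_degree \<iota>"
  by (simp add: deg_def ext_degree_def)

lemma finite_spanning: "\<exists>B. finite B \<and> vs.span B = UNIV"
  using finite_ext unfolding finite_ext_def by blast

lemma independent_finite_card:
  assumes "vs.independent S"
  shows "finite S" "card S \<le> deg"
proof -
  obtain B where B: "finite B" "vs.span B = UNIV" using finite_spanning by blast
  obtain B' where B': "vs.independent B'" "vs.span B' = UNIV"
    using vs.basis_exists[of UNIV] by (metis top.extremum_uniqueI)
  have "finite B'" using vs.independent_span_bound[of B B'] B B' by simp
  then show "finite S" "card S \<le> deg"
    using vs.independent_span_bound[of B' S] B' assms
      vs.basis_card_eq_dim[of B' UNIV] unfolding deg_def by auto
qed

lemma exists_basis_set: obtains B where "finite B" "vs.independent B" "vs.span B = UNIV"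
  using vs.basis_exists[of UNIV] independent_finite_card by (metis top.extremum_uniqueI)

lemma card_basis: "vs.independent B \<Longrightarrow> vs.span B = UNIV \<Longrightarrow> card B = deg"
  using vs.basis_card_eq_dim[of B UNIV] unfolding deg_def by auto

section \<open>Bases, coordinates and multiplication matrices\<close>

definition kbasis :: "(nat \<Rightarrow> 'b) \<Rightarrow> bool" where
  "kbasis e \<longleftrightarrow> (\<forall>y. \<exists>c. y = (\<Sum>i<deg. \<iota> (c i) * e i)) \<and>
    (\<forall>c. (\<Sum>i<deg. \<iota> (c i) * e i) = 0 \<longrightarrow> (\<forall>i<deg. c i = 0))"

lemma kbasis_of_set:
  assumes B: "finite B" "vs.independent B" "vs.span B = UNIV"
  obtains e where "kbasis e" "bij_betw e {..<deg} B"
proof -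
  obtain e where e: "bij_betw e {..<deg} B"
    using ex_bij_betw_nat_finite[OF B(1)] card_basis[OF B(2,3)] by (auto simp: atLeast0LessThan)
  have re: "(\<Sum>i<deg. \<iota> (u (e i)) * e i) = (\<Sum>b\<in>B. \<iota> (u b) * b)" for u
    using sum.reindex_bij_betw[OF e] .
  have "kbasis e" unfolding kbasis_def
  proof (intro conjI allI impI)
    fix y
    have "y \<in> range (\<lambda>u. \<Sum>b\<in>B. \<iota> (u b) * b)" using B(3) vs.span_finite[OF B(1)] by simp
    then obtain u where "y = (\<Sum>b\<in>B. \<iota> (u b) * b)" by blast
    then show "\<exists>c. y = (\<Sum>i<deg. \<iota> (c i) * e i)" using re by metis
  next
    fix c i assume c: "(\<Sum>i<deg. \<iota> (c i) * e i) = 0" and i: "i < deg"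
    have inv: "the_inv_into {..<deg} e (e i) = i" if "i < deg" for i
      using e that by (auto simp: bij_betw_def the_inv_into_f_f)
    define u where "u b = c (the_inv_into {..<deg} e b)" for b
    have "(\<Sum>b\<in>B. \<iota> (u b) * b) = 0"
      using c unfolding re[symmetric] by (simp add: u_def inv)
    moreover have "e i \<in> B" using e i by (auto simp: bij_betw_def)
    ultimately have "u (e i) = 0"
      using B(2) unfolding vs.dependent_finite[OF B(1)] by blast
    then show "c i = 0" by (simp add: u_def inv i)
  qed
  with e show ?thesis using that by blast
qed

lemma exists_kbasis: "\<exists>e. kbasis e"
  using exists_basis_set kbasis_of_set by metis

text \<open>Entries at \<open>deg\<close> and above are arbitrary, hence the bounds
  \<open>i < deg\<close> in what follows.\<close>

definition coord :: "(nat \<Rightarrow> 'b) \<Rightarrow> 'b \<Rightarrow> nat \<Rightarrow> 'a" where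
  "coord e y = (SOME c. y = (\<Sum>i<deg. \<iota> (c i) * e i))"

lemma coord:
  assumes "kbasis e"
  shows "(\<Sum>i<deg. \<iota> (coord e y i) * e i) = y"
proof -
  have "\<exists>c. y = (\<Sum>i<deg. \<iota> (c i) * e i)" using assms unfolding kbasis_def by blast
  from someI_ex[OF this] show ?thesis unfolding coord_def by (rule sym)
qed

lemma coord_unique:
  assumes "kbasis e" "y = (\<Sum>i<deg. \<iota> (c i) * e i)" "i < deg"
  shows "coord e y i = c i"
proof -
  have "(\<Sum>i<deg. \<iota> (coord e y i - c i) * e i) = 0"
    using coord[OF assms(1), of y] assms(2) by (simp add: hom_diff left_diff_distrib sum_subtractf)
  then show ?thesis using assms unfolding kbasis_def by fastforce
qed

lemma coord_add:
  assumes "kbasis e" "i < deg"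
  shows "coord e (x + y) i = coord e x i + coord e y i"
  by (rule coord_unique[OF assms(1) _ assms(2), where c = "\<lambda>i. coord e x i + coord e y i"])
    (simp add: hom_add distrib_right sum.distrib coord[OF assms(1)])

lemma coord_scale:
  assumes "kbasis e" "i < deg"
  shows "coord e (\<iota> c * y) i = c * coord e y i"
  by (rule coord_unique[OF assms(1) _ assms(2), where c = "\<lambda>i. c * coord e y i"])
    (simp add: hom_mult mult.assoc sum_distrib_left[symmetric] coord[OF assms(1)])

lemma coord_sum:
  assumes "kbasis e" "i < deg"
  shows "coord e (sum f S) i = (\<Sum>s\<in>S. coord e (f s) i)"
proof (induction S rule: infinite_finite_induct)
  case (insert x F)
  then show ?case by (simp add: coord_add[OF assms])
qed (use coord_scale[OF assms, of 0 0] in simp_all)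

lemma coord_basis:
  assumes "kbasis e" "i < deg" "j < deg"
  shows "coord e (e j) i = (if i = j then 1 else 0)"
proof (rule coord_unique[OF assms(1) _ assms(2), where c = "\<lambda>i. if i = j then 1 else 0"])
  have "(\<Sum>i<deg. \<iota> (if i = j then 1 else 0) * e i) = (\<Sum>i<deg. if i = j then e i else 0)"
    by (intro sum.cong) auto
  then show "e j = (\<Sum>i<deg. \<iota> (if i = j then 1 else 0) * e i)" using assms(3) by simp
qed

text \<open>Multiplication by \<open>y\<close>, read from the basis \<open>e\<close> into the basis
  \<open>e'\<close>; for \<open>y = 1\<close> this is the base change matrix.\<close>

definition mulmat :: "(nat \<Rightarrow> 'b) \<Rightarrow> (nat \<Rightarrow> 'b) \<Rightarrow> 'b \<Rightarrow> 'a mat" where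
  "mulmat e e' y = mat deg deg (\<lambda>(i, j). coord e' (y * e j) i)"

lemma mulmat_carrier [simp]: "mulmat e e' y \<in> carrier_mat deg deg"
  by (simp add: mulmat_def)

lemma mulmat_mult:
  assumes "kbasis e'" "kbasis e''"
  shows "mulmat e e'' (x * y) = mulmat e' e'' x * mulmat e e' y"
proof (rule eq_matI)
  fix i j assume "i < dim_row (mulmat e' e'' x * mulmat e e' y)"
    "j < dim_col (mulmat e' e'' x * mulmat e e' y)"
  then have i: "i < deg" and j: "j < deg" by (simp_all add: mulmat_def)
  have "x * y * e j = (\<Sum>k<deg. \<iota> (coord e' (y * e j) k) * (x * e' k))"
    using arg_cong[OF coord[OF assms(1), of "y * e j"], of "(*) x"]
    by (simp add: sum_distrib_left algebra_simps)
  then have "coord e'' (x * y * e j) i =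
      (\<Sum>k<deg. coord e' (y * e j) k * coord e'' (x * e' k) i)"
    by (simp add: coord_sum[OF assms(2) i] coord_scale[OF assms(2) i])
  then show "mulmat e e'' (x * y) $$ (i, j) = (mulmat e' e'' x * mulmat e e' y) $$ (i, j)"
    using i j by (simp add: mulmat_def scalar_prod_def atLeast0LessThan mult.commute)
qed (simp_all add: mulmat_def)

lemma mulmat_hom:
  assumes "kbasis e"
  shows "mulmat e e (\<iota> c) = c \<cdot>\<^sub>m 1\<^sub>m deg"
  by (rule eq_matI) (auto simp: mulmat_def coord_scale[OF assms] coord_basis[OF assms])

text \<open>The two matrices of \<open>y\<close> are conjugate under the base change
  \<open>mulmat e e' 1\<close>.\<close>

lemma det_mulmat_basis_change:
  assumes "kbasis e" "kbasis e'"
  shows "det (mulmat e e y) = det (mulmat e' e' y)"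
proof -
  have "det (mulmat e' e 1) * det (mulmat e e' 1) = 1"
    using mulmat_mult[OF assms(2,1), of e 1 1] mulmat_hom[OF assms(1), of 1]
    by (simp flip: det_mult[OF mulmat_carrier mulmat_carrier])
  then have nz: "det (mulmat e e' 1) \<noteq> 0" by auto
  have "mulmat e' e' y * mulmat e e' 1 = mulmat e e' 1 * mulmat e e y"
    using mulmat_mult[OF assms(2,2), of e y 1] mulmat_mult[OF assms, of e 1 y] by simp
  then have "det (mulmat e' e' y) * det (mulmat e e' 1) = det (mulmat e e' 1) * det (mulmat e e y)"
    by (simp flip: det_mult[OF mulmat_carrier mulmat_carrier])
  then show ?thesis using nz by simp
qed

section \<open>The norm as a determinant\<close>

text \<open>A determinant rather than a product of conjugates covers inseparable extensions and is
  visibly polynomial in coordinates.\<close>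

definition nrm :: "'b \<Rightarrow> 'a" where
  "nrm y = det (mulmat (SOME e. kbasis e) (SOME e. kbasis e) y)"

lemma nrm_eq: "kbasis e \<Longrightarrow> nrm y = det (mulmat e e y)"
  unfolding nrm_def by (rule det_mulmat_basis_change[OF someI_ex[OF exists_kbasis]])

lemma nrm_mult: "nrm (x * y) = nrm x * nrm y"
proof -
  obtain e where e: "kbasis e" using exists_kbasis by blast
  show ?thesis
    by (simp add: nrm_eq[OF e] mulmat_mult[OF e e] det_mult[OF mulmat_carrier mulmat_carrier])
qed

lemma nrm_hom: "nrm (\<iota> c) = c ^ deg"
proof -
  obtain e where e: "kbasis e" using exists_kbasis by blast
  show ?thesis by (simp add: nrm_eq[OF e] mulmat_hom[OF e])
qed

lemma nrm_one [simp]: "nrm 1 = 1"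
  using nrm_hom[of 1] by simp

lemma nrm_power: "nrm (y ^ k) = nrm y ^ k"
  by (induction k) (simp_all add: nrm_mult)

lemma nrm_inverse: "y \<noteq> 0 \<Longrightarrow> nrm y * nrm (inverse y) = 1"
  by (simp flip: nrm_mult)

lemma deg_pos: "0 < deg"
proof (rule ccontr)
  assume "\<not> 0 < deg"
  then have "(1::'b) = 0" using coord[of _ 1] exists_kbasis by auto
  then show False by simp
qed

lemma nrm_eq_0_iff [simp]: "nrm y = 0 \<longleftrightarrow> y = 0"
  using nrm_inverse[of y] nrm_hom[of 0] deg_pos by (cases "y = 0") auto

text \<open>Products are expanded with the structure constants \<open>coord e (e k * e l) i\<close>
  of the algebra \<open>L\<close>.\<close>

lemma polyfun_coord:
  assumes "kbasis e" "i < deg" "Q \<in> polyfun \<iota> I"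
  shows "(\<lambda>a. coord e (Q a) i) \<in> polyfun (\<lambda>x. x) I"
  using assms(3,2)
proof (induction arbitrary: i)
  case (const c)
  show ?case by (rule polyfun.const)
next
  case (var k)
  then show ?case
    using polyfun.mult[OF polyfun.var[of k I "\<lambda>x. x"] polyfun.const[of "coord e 1 i"]]
      coord_scale[OF assms(1) var(2), of _ 1] by simp
next
  case (add p q)
  then show ?case by (simp add: coord_add[OF assms(1)] polyfun.add)
next
  case (mult p q)
  have "p a * q a = (\<Sum>k<deg. \<Sum>l<deg. \<iota> (coord e (p a) k * coord e (q a) l) * (e k * e l))" for a
    using arg_cong2[OF coord[OF assms(1), of "p a"] coord[OF assms(1), of "q a"], of "(*)"]
    by (simp add: sum_product hom_mult algebra_simps)
  then have "coord e (p a * q a) i =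
      (\<Sum>k<deg. \<Sum>l<deg. (coord e (p a) k * coord e (q a) l) * coord e (e k * e l) i)" for a
    by (simp add: coord_sum[OF assms(1) mult.prems] coord_scale[OF assms(1) mult.prems])
  then show ?case
    using mult.IH by (simp only:) (intro polyfun_sum polyfun.mult polyfun.const; simp)
qed

text \<open>By the Leibniz formula, since the matrix entries are coordinates of \<open>Q a\<close>
  times basis vectors. This is how extremality of \<open>K\<close> reaches \<open>L\<close>-valued
  functions.\<close>

lemma polyfun_nrm:
  assumes "Q \<in> polyfun \<iota> I"
  shows "(\<lambda>a. nrm (Q a)) \<in> polyfun (\<lambda>x. x) I"
proof -
  obtain e where e: "kbasis e" using exists_kbasis by blast
  have "nrm (Q a) = (\<Sum>p | p permutes {0..<deg}. signof p *
      (\<Prod>i = 0..<deg. coord e (Q a * e (p i)) i))" for a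
    unfolding nrm_eq[OF e] det_def'[OF mulmat_carrier]
    by (intro sum.cong refl arg_cong2[of _ _ _ _ "(*)"] prod.cong)
      (auto simp: mulmat_def permutes_in_image dest: permutes_in_image)
  then show ?thesis
    by (simp only:) (intro polyfun_sum polyfun_prod polyfun.mult[OF polyfun.const]
      polyfun_coord[OF e] polyfun.mult[OF assms polyfun.const]; simp)
qed

lemma polyfun_hom:
  "p \<in> polyfun (\<lambda>x. x) I \<Longrightarrow> (\<lambda>a. \<iota> (p a)) \<in> polyfun \<iota> I"
  by (induction rule: polyfun.induct) (simp_all add: hom_add hom_mult polyfun.intros)

lemma exists_algebraic_relation:
  obtains d c i where "i \<le> d" "c i \<noteq> 0" "(\<Sum>i\<le>d. \<iota> (c i) * y ^ i) = 0"
proof (cases "inj_on (\<lambda>i. y ^ i) {..deg}")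
  case True
  let ?P = "(\<lambda>i. y ^ i) ` {..deg}"
  have "card ?P = Suc deg" using card_image[OF True] by simp
  then have "vs.dependent ?P" using independent_finite_card(2)[of ?P] by linarith
  then obtain u i where "i \<le> deg" "u (y ^ i) \<noteq> 0" "(\<Sum>b\<in>?P. \<iota> (u b) * b) = 0"
    unfolding vs.dependent_finite[OF finite_imageI[OF finite_atMost]] by auto
  then show ?thesis using that[of i deg "\<lambda>i. u (y ^ i)"] by (simp add: sum.reindex[OF True])
next
  \<comment> \<open>Independence of a set does not see repetitions: if two powers coincide, their
    difference is the relation.\<close>
  case False
  then obtain i j where ij: "i < j" "y ^ i = y ^ j" by (metis inj_onI linorder_neqE_nat)
  define c :: "nat \<Rightarrow> 'a" where "c k = (if k = i then 1 else if k = j then -1 else 0)" for k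
  have "(\<Sum>k\<le>j. \<iota> (c k) * y ^ k) = (\<Sum>k\<in>{i, j}. \<iota> (c k) * y ^ k)"
    using ij by (intro sum.mono_neutral_right) (auto simp: c_def)
  also have "\<dots> = 0" using ij by (simp add: c_def)
  finally show ?thesis using that[of i j c] ij by (simp add: c_def)
qed

end

section \<open>The value of the norm\<close>

locale extremal_extension =
  V: extremal_valued v + finite_extension \<iota> + W: valued w
  for v :: "'a::field \<Rightarrow> 'g::linordered_ab_group_add" and \<iota> :: "'a \<Rightarrow> 'b::field"
    and w :: "'b \<Rightarrow> 'g" +
  assumes val_hom: "x \<noteq> 0 \<Longrightarrow> w (\<iota> x) = v x"
begin

lemma vle_hom [simp]: "W.vle (\<iota> x) (\<iota> y) \<longleftrightarrow> V.vle x y"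
  by (cases "x = 0"; cases "y = 0") (auto simp: V.vle_def W.vle_def val_hom)

lemma vle_one_hom [simp]: "W.vle 1 (\<iota> y) \<longleftrightarrow> V.vle 1 y" "W.vle (\<iota> y) 1 \<longleftrightarrow> V.vle y 1"
  using vle_hom[of 1 y] vle_hom[of y 1] by simp_all

lemma val_ring_hom [simp]: "\<iota> x \<in> val_ring w \<longleftrightarrow> x \<in> val_ring v"
  by (simp add: V.in_val_ring_iff W.in_val_ring_iff)

section \<open>Modules and orders over the valuation ring of \<open>v\<close>\<close>

text \<open>The submodule of \<open>L\<close> generated by \<open>H\<close> over the valuation ring
  of \<open>v\<close>.\<close>

inductive_set Osp :: "'b set \<Rightarrow> 'b set" for H where
  Osp_zero [simp]: "0 \<in> Osp H"
| Osp_step: "h \<in> H \<Longrightarrow> c \<in> val_ring v \<Longrightarrow> x \<in> Osp H \<Longrightarrow> \<iota> c * h + x \<in> Osp H"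

lemma Osp_base: "h \<in> H \<Longrightarrow> h \<in> Osp H"
  using Osp_step[of h H 1 0] by simp

lemma Osp_add: "x \<in> Osp H \<Longrightarrow> y \<in> Osp H \<Longrightarrow> x + y \<in> Osp H"
  by (induction rule: Osp.induct) (simp_all add: add.assoc Osp_step)

lemma Osp_scale: "x \<in> Osp H \<Longrightarrow> c \<in> val_ring v \<Longrightarrow> \<iota> c * x \<in> Osp H"
proof (induction rule: Osp.induct)
  case (Osp_step h c' x)
  then have "\<iota> (c * c') * h + \<iota> c * x \<in> Osp H"
    by (intro Osp.Osp_step V.val_ring_mult)
  then show ?case by (simp add: hom_mult algebra_simps)
qed simp

lemma Osp_uminus: "x \<in> Osp H \<Longrightarrow> - x \<in> Osp H"
  using Osp_scale[of x H "-1"] by simp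

lemma Osp_diff: "x \<in> Osp H \<Longrightarrow> y \<in> Osp H \<Longrightarrow> x - y \<in> Osp H"
  using Osp_add[of x H "- y"] Osp_uminus[of y H] by simp

lemma Osp_sum: "(\<And>i. i \<in> I \<Longrightarrow> f i \<in> Osp H) \<Longrightarrow> sum f I \<in> Osp H"
  by (induction I rule: infinite_finite_induct) (auto intro: Osp_add)

lemma Osp_trans: "x \<in> Osp H \<Longrightarrow> H \<subseteq> Osp H' \<Longrightarrow> x \<in> Osp H'"
  by (induction rule: Osp.induct) (auto intro: Osp_add Osp_scale)

text \<open>Turns membership into a choice of finitely many parameters in the valuation ring, the
  form to which \<open>V.polyfun_max\<close> applies.\<close>

lemma Osp_coeffs:
  assumes "x \<in> Osp H" "finite H"
  obtains c where "\<And>h. c h \<in> val_ring v" "x = (\<Sum>h\<in>H. \<iota> (c h) * h)"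
  using assms(1)
proof (induction arbitrary: thesis rule: Osp.induct)
  case Osp_zero
  show ?case by (rule Osp_zero[of "\<lambda>_. 0"]) simp_all
next
  case (Osp_step h c' x)
  obtain c where c: "\<And>h. c h \<in> val_ring v" "x = (\<Sum>h\<in>H. \<iota> (c h) * h)"
    using Osp_step.IH by blast
  show ?case
  proof (rule Osp_step.prems)
    show "(c(h := c' + c h)) h' \<in> val_ring v" for h'
      using c(1) Osp_step.hyps by (auto intro: V.val_ring_add)
    show "\<iota> c' * h + x = (\<Sum>k\<in>H. \<iota> ((c(h := c' + c h)) k) * k)"
      unfolding c(2) sum.remove[OF assms(2) Osp_step.hyps(1)]
      by (simp add: hom_add algebra_simps)
  qed
qed

lemma Osp_mult:
  assumes "\<And>g h. g \<in> H \<Longrightarrow> h \<in> H \<Longrightarrow> g * h \<in> Osp H'" "x \<in> Osp H" "y \<in> Osp H"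
  shows "x * y \<in> Osp H'"
  using assms(2)
proof induction
  case (Osp_step g c x)
  have "g * y \<in> Osp H'" using assms(3)
  proof induction
    case (Osp_step h c' y)
    have "g * h \<in> Osp H'" using \<open>g \<in> H\<close> Osp_step(1) by (rule assms(1))
    then have "\<iota> c' * (g * h) + g * y \<in> Osp H'"
      using Osp_step by (intro Osp_add Osp_scale)
    then show ?case by (simp add: algebra_simps)
  qed simp
  then have "\<iota> c * (g * y) + x * y \<in> Osp H'"
    using Osp_step by (intro Osp_add Osp_scale)
  then show ?case by (simp add: algebra_simps)
qed simp

lemma Osp_span: "x \<in> Osp H \<Longrightarrow> x \<in> vs.span H"
  by (induction rule: Osp.induct)
    (auto intro: vs.span_add vs.span_scale vs.span_base vs.span_zero)

text \<open>Finitely generated torsion-free modules over a valuation ring are free: dividing a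
  linear relation by a coefficient of least value makes its generator redundant.\<close>

lemma Osp_reduce:
  assumes "finite G"
  shows "\<exists>G'\<subseteq>G. vs.independent G' \<and> G \<subseteq> Osp G'"
  using assms
proof (induction rule: finite_psubset_induct)
  case (psubset G)
  show ?case
  proof (cases "vs.independent G")
    case True
    then show ?thesis using Osp_base by blast
  next
    case False
    then obtain u g1 where u: "(\<Sum>g\<in>G. \<iota> (u g) * g) = 0" and g1: "g1 \<in> G" "u g1 \<noteq> 0"
      unfolding vs.dependent_finite[OF psubset.hyps(1)] by blast
    obtain g0 where g0: "g0 \<in> {g\<in>G. u g \<noteq> 0}"
      "\<And>g. g \<in> {g\<in>G. u g \<noteq> 0} \<Longrightarrow> V.vle (u g0) (u g)"
    proof (rule V.exists_vle_min[of "{g\<in>G. u g \<noteq> 0}" u])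
      show "finite {g\<in>G. u g \<noteq> 0}" "{g\<in>G. u g \<noteq> 0} \<noteq> {}" using g1 psubset.hyps by auto
    qed blast
    have min: "u g / u g0 \<in> val_ring v" if "g \<in> G" for g
      using g0(2)[of g] that g0(1) by (cases "u g = 0") (auto simp: V.in_val_ring_iff V.vle_divide_iff)
    have "\<iota> (u g0) * g0 = - (\<Sum>g\<in>G - {g0}. \<iota> (u g) * g)"
      using u sum.remove[OF psubset.hyps(1), of g0 "\<lambda>g. \<iota> (u g) * g"] g0(1)
      by (simp add: eq_neg_iff_add_eq_0)
    moreover have "- (\<iota> (u g / u g0) * g) = - inverse (\<iota> (u g0)) * (\<iota> (u g) * g)" for g
      by (simp add: divide_inverse hom_mult hom_inverse)
    ultimately have "(\<Sum>g\<in>G - {g0}. - (\<iota> (u g / u g0) * g)) = inverse (\<iota> (u g0)) * (\<iota> (u g0) * g0)"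
      by (simp only: sum_distrib_left[symmetric] mult_minus_left mult_minus_right sum_negf)
    moreover have "inverse (\<iota> (u g0)) * (\<iota> (u g0) * g0) = g0"
      using g0(1) by (simp add: mult.assoc[symmetric])
    ultimately have "g0 = (\<Sum>g\<in>G - {g0}. - (\<iota> (u g / u g0) * g))" by simp
    moreover have "(\<Sum>g\<in>G - {g0}. - (\<iota> (u g / u g0) * g)) \<in> Osp (G - {g0})"
      by (intro Osp_sum Osp_uminus Osp_scale Osp_base) (use min in auto)
    ultimately have g0': "g0 \<in> Osp (G - {g0})" by metis
    obtain G' where G': "G' \<subseteq> G - {g0}" "vs.independent G'" "G - {g0} \<subseteq> Osp G'"
      using psubset.IH[of "G - {g0}"] g0(1) by blast
    have "G \<subseteq> Osp G'" using G'(3) Osp_trans[OF g0' G'(3)] by blast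
    then show ?thesis using G' by blast
  qed
qed

lemma det_in_val_ring:
  assumes "A \<in> carrier_mat n n" "\<And>i j. i < n \<Longrightarrow> j < n \<Longrightarrow> A $$ (i, j) \<in> val_ring v"
  shows "det A \<in> val_ring v"
proof -
  have "(signof p :: 'a) \<in> val_ring v" for p :: "nat \<Rightarrow> nat"
    by (cases "sign p = 1") (auto simp: sign_def)
  then show ?thesis
    unfolding det_def'[OF assms(1)]
    by (intro V.val_ring_sum V.val_ring_mult V.val_ring_prod assms(2))
      (auto dest: permutes_in_image)
qed

text \<open>\<open>Osp H\<close> is then a ring, finitely generated as a module over the valuation
  ring of \<open>v\<close> and contained in that of \<open>w\<close>; it may span a proper subspace
  of \<open>L\<close>.\<close>

definition is_order :: "'b set \<Rightarrow> bool" where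
  "is_order H \<longleftrightarrow> finite H \<and> 1 \<in> H \<and> H \<subseteq> val_ring w \<and> (\<forall>g\<in>H. \<forall>h\<in>H. g * h \<in> Osp H)"

lemma order_val_ring:
  assumes "is_order H" "x \<in> Osp H"
  shows "x \<in> val_ring w"
  using assms(2)
proof induction
  case (Osp_step h c x)
  then show ?case using assms(1) unfolding is_order_def
    by (intro W.val_ring_add W.val_ring_mult) auto
qed simp

lemma order_mult: "is_order H \<Longrightarrow> x \<in> Osp H \<Longrightarrow> y \<in> Osp H \<Longrightarrow> x * y \<in> Osp H"
  unfolding is_order_def using Osp_mult by blast

lemma order_one: "is_order H \<Longrightarrow> 1 \<in> Osp H"
  unfolding is_order_def using Osp_base by blast

lemma order_power: "is_order H \<Longrightarrow> x \<in> Osp H \<Longrightarrow> x ^ k \<in> Osp H"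
  by (induction k) (auto intro: order_mult order_one)

text \<open>Multiplication by \<open>x\<close> preserves the module generated by the products of
  \<open>H\<close> with a basis of \<open>L\<close>. This module has a free basis that is a basis of
  \<open>L\<close>, and there the matrix of \<open>x\<close> is integral.\<close>

lemma nrm_order:
  assumes H: "is_order H" and x: "x \<in> Osp H"
  shows "nrm x \<in> val_ring v"
proof -
  have finH: "finite H" and H1: "1 \<in> H" using H by (auto simp: is_order_def)
  obtain B where B: "finite B" "vs.independent B" "vs.span B = UNIV"
    by (rule exists_basis_set)
  \<comment> \<open>Multiplying by \<open>B\<close> enlarges \<open>Osp H\<close> to a module
    spanning \<open>L\<close>; \<open>1 \<in> H\<close> keeps \<open>B\<close> inside
    \<open>G\<close>.\<close>
  define G where "G = (\<lambda>(h, b). h * b) ` (H \<times> B)"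
  have finG: "finite G" unfolding G_def using finH B(1) by blast
  obtain G' where G': "G' \<subseteq> G" "vs.independent G'" "G \<subseteq> Osp G'"
    using Osp_reduce[OF finG] by blast
  have finG': "finite G'" using finG G'(1) finite_subset by blast
  have "b \<in> G" if "b \<in> B" for b
    using H1 that unfolding G_def by (intro image_eqI[of _ _ "(1, b)"]) auto
  then have "B \<subseteq> vs.span G'" using G'(3) Osp_span by blast
  then have "vs.span G' = UNIV" using vs.span_mono[of B "vs.span G'"] B(3) by (auto simp: vs.span_span)
  then obtain e where e: "kbasis e" "bij_betw e {..<deg} G'"
    using kbasis_of_set[OF finG' G'(2)] by blast
  have xe: "x * e j \<in> Osp G'" if "j < deg" for j
  proof -
    have "e j \<in> G" using that e(2) G'(1) by (auto simp: bij_betw_def)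
    then obtain h b where hb: "h \<in> H" "b \<in> B" "e j = h * b" unfolding G_def by auto
    have "y * b \<in> Osp G" if "y \<in> Osp H" for y
      using that
    proof induction
      case (Osp_step k c y)
      have "k * b \<in> G" using Osp_step(1) hb(2) unfolding G_def by auto
      then have "\<iota> c * (k * b) + y * b \<in> Osp G" using Osp_step by (intro Osp.Osp_step)
      then show ?case by (simp add: algebra_simps)
    qed simp
    from this[OF order_mult[OF H x Osp_base[OF hb(1)]]]
    have "x * e j \<in> Osp G" by (simp add: hb(3) mult.assoc)
    then show ?thesis using Osp_trans G'(3) by blast
  qed
  show ?thesis
    unfolding nrm_eq[OF e(1)]
  proof (rule det_in_val_ring[OF mulmat_carrier])
    fix i j assume ij: "i < deg" "j < deg"
    obtain c where c: "\<And>h. c h \<in> val_ring v" "x * e j = (\<Sum>g\<in>G'. \<iota> (c g) * g)"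
      using Osp_coeffs[OF xe[OF ij(2)] finG'] by blast
    have "coord e (x * e j) i = c (e i)"
      by (rule coord_unique[OF e(1) _ ij(1), where c = "\<lambda>i. c (e i)"])
        (simp add: c(2) sum.reindex_bij_betw[OF e(2), of "\<lambda>g. \<iota> (c g) * g"])
    then show "mulmat e e x $$ (i, j) \<in> val_ring v" using ij c(1) by (simp add: mulmat_def)
  qed
qed

text \<open>The set \<open>1 + b \<cdot> Osp H\<close> is multiplicatively closed and omits \<open>0\<close>, so the maximum of
  the values of its norms, attained by extremality, cannot increase under squaring.\<close>

lemma nrm_principal_units:
  assumes H: "is_order H" and b: "b \<in> Osp H" "W.vlt 1 b" and x: "x \<in> Osp H"
  shows "V.vle (nrm (1 + b * x)) 1"
proof -
  have finH: "finite H" using H by (simp add: is_order_def)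
  define Q where "Q a = 1 + b * (\<Sum>h\<in>H. \<iota> (a h) * h)" for a
  have "Q \<in> polyfun \<iota> H"
    unfolding Q_def by (intro polyfun.add polyfun.mult polyfun.const polyfun_sum polyfun.var)
  from polyfun_nrm[OF this] obtain a where a: "\<And>h. h \<in> H \<Longrightarrow> a h \<in> val_ring v"
    and max: "\<And>a'. (\<And>h. h \<in> H \<Longrightarrow> a' h \<in> val_ring v) \<Longrightarrow> V.vle (nrm (Q a')) (nrm (Q a))"
    using V.polyfun_max[OF finH] by blast
  have max': "V.vle (nrm (1 + b * y)) (nrm (Q a))" if "y \<in> Osp H" for y
  proof -
    obtain c where "\<And>h. c h \<in> val_ring v" "y = (\<Sum>h\<in>H. \<iota> (c h) * h)"
      using Osp_coeffs[OF \<open>y \<in> Osp H\<close> finH] by blast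
    then show ?thesis using max[of c] by (simp add: Q_def)
  qed
  define z where "z = (\<Sum>h\<in>H. \<iota> (a h) * h)"
  have z: "z \<in> Osp H"
    unfolding z_def by (intro Osp_sum Osp_scale Osp_base a)
  have Qz: "Q a = 1 + b * z" by (simp add: Q_def z_def)
  have "W.vlt 1 (b * z)"
    using W.vlt_mult[OF b(2), of 1 z] order_val_ring[OF H z] by (simp add: W.in_val_ring_iff)
  \<comment> \<open>The maximal value is finite, so it can be cancelled after squaring.\<close>
  have "Q a \<noteq> 0"
  proof
    assume "Q a = 0"
    then have "b * z = - 1" unfolding Qz by (simp add: eq_neg_iff_add_eq_0 add.commute)
    with \<open>W.vlt 1 (b * z)\<close> show False by simp
  qed
  moreover have "V.vle (nrm (Q a) * nrm (Q a)) (nrm (Q a))"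
  proof -
    have "Q a * Q a = 1 + b * (z + z + b * (z * z))"
      by (simp add: Qz algebra_simps)
    moreover have "z + z + b * (z * z) \<in> Osp H"
      by (intro Osp_add order_mult[OF H] z b)
    ultimately show ?thesis using max' unfolding nrm_mult[symmetric] by simp
  qed
  ultimately have "V.vle (nrm (Q a)) 1"
    using V.vle_mult_right_cancel[of "nrm (Q a)" "nrm (Q a)" 1] by simp
  then show ?thesis using max'[OF x] V.vle_trans by blast
qed

section \<open>Norms of elements of value 0\<close>

text \<open>Division by a coefficient of least value makes all coefficients integral and one of them
  \<open>1\<close>, possibly not the leading one.\<close>

lemma exists_primitive_relation:
  obtains d c k where "\<And>i. c i \<in> val_ring v" "\<And>i. d < i \<Longrightarrow> c i = 0" "k \<le> d" "c k = 1"
    "(\<Sum>i\<le>d. \<iota> (c i) * y ^ i) = 0"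
proof -
  obtain d c i where r: "i \<le> d" "c i \<noteq> 0" "(\<Sum>i\<le>d. \<iota> (c i) * y ^ i) = 0"
    by (rule exists_algebraic_relation[of y])
  obtain k where k: "k \<in> {i. i \<le> d \<and> c i \<noteq> 0}"
    "\<And>j. j \<in> {i. i \<le> d \<and> c i \<noteq> 0} \<Longrightarrow> V.vle (c k) (c j)"
    using V.exists_vle_min[of "{i. i \<le> d \<and> c i \<noteq> 0}" c] r(1,2) by auto
  define c' where "c' i = (if i \<le> d then c i / c k else 0)" for i
  show ?thesis
  proof (rule that[of c' d k])
    show "c' i \<in> val_ring v" for i
      using k(1) k(2)[of i] by (cases "c i = 0") (auto simp: c'_def V.in_val_ring_iff V.vle_divide_iff)
    have "(\<Sum>i\<le>d. \<iota> (c' i) * y ^ i) = inverse (\<iota> (c k)) * (\<Sum>i\<le>d. \<iota> (c i) * y ^ i)"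
      by (simp add: c'_def hom_mult hom_inverse divide_inverse sum_distrib_left algebra_simps)
    then show "(\<Sum>i\<le>d. \<iota> (c' i) * y ^ i) = 0" using r(3) by simp
  qed (use k(1) in \<open>auto simp: c'_def\<close>)
qed

text \<open>A primitive relation provides \<open>z\<close> and \<open>b\<close> in the order with
  \<open>u z = 1 - b\<close> and \<open>b\<close> of positive value. Then
  \<open>v (N u) + v (N z) \<le> 0\<close>, while \<open>v (N z) \<ge> 0\<close>.\<close>

lemma nrm_order_unit:
  assumes H: "is_order H" and u: "u \<in> Osp H" "W.vle u 1"
  shows "V.vle (nrm u) 1"
proof -
  obtain d c k where c: "\<And>i. c i \<in> val_ring v" "k \<le> d" "c k = 1"
    and rel: "(\<Sum>i\<le>d. \<iota> (c i) * u ^ i) = 0"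
    by (rule exists_primitive_relation[of u]) blast
  \<comment> \<open>The first coefficient of value 0: all terms before it have positive value and
    are split off.\<close>
  define s where "s = (LEAST s. V.vle (c s) 1)"
  have s: "V.vle (c s) 1" unfolding s_def by (rule LeastI[of _ k]) (simp add: c)
  have small: "V.vlt 1 (c i)" if "i < s" for i using not_less_Least that unfolding s_def by blast
  have sd: "s \<le> d" using Least_le[of "\<lambda>s. V.vle (c s) 1" k] c unfolding s_def by simp
  have cs: "c s \<noteq> 0" using s by auto
  have uO: "u ^ i \<in> val_ring w" for i by (rule order_val_ring[OF H order_power[OF H u(1)]])
  define q where "q = (\<Sum>i\<in>{Suc s..d}. \<iota> (c i) * u ^ (i - Suc s))"
  have q: "q \<in> Osp H"
    unfolding q_def by (intro Osp_sum Osp_scale order_power[OF H] u c)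
  have "(\<Sum>i\<in>{Suc s..d}. \<iota> (c i) * u ^ i) = u ^ s * (u * q)"
    unfolding q_def sum_distrib_left
  proof (intro sum.cong refl)
    fix i assume "i \<in> {Suc s..d}"
    then have "u ^ i = u ^ (Suc s + (i - Suc s))" by simp
    then have "u ^ i = u ^ s * u * u ^ (i - Suc s)" unfolding power_add by simp
    then show "\<iota> (c i) * u ^ i = u ^ s * (u * (\<iota> (c i) * u ^ (i - Suc s)))" by simp
  qed
  moreover have "(\<Sum>i\<le>d. \<iota> (c i) * u ^ i) = (\<Sum>i<s. \<iota> (c i) * u ^ i) +
      (\<iota> (c s) * u ^ s + (\<Sum>i\<in>{Suc s..d}. \<iota> (c i) * u ^ i))"
  proof -
    have "{..d} = {..<s} \<union> {s..d}" "{..<s} \<inter> {s..d} = {}" using sd by auto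
    then show ?thesis using sd by (simp add: sum.union_disjoint sum.atLeast_Suc_atMost)
  qed
  ultimately have "(\<Sum>i<s. \<iota> (c i) * u ^ i) + u ^ s * (\<iota> (c s) + u * q) = 0"
    using rel by (simp add: algebra_simps)
  then have "u ^ s * (\<iota> (c s) + u * q) = - (\<Sum>i<s. \<iota> (c i) * u ^ i)"
    by (simp add: eq_neg_iff_add_eq_0 add.commute)
  moreover have "W.vlt 1 (\<Sum>i<s. \<iota> (c i) * u ^ i)"
  proof (rule W.vlt_sum)
    fix i assume "i \<in> {..<s}"
    then show "W.vlt 1 (\<iota> (c i) * u ^ i)"
      using W.vlt_mult[where x = 1 and y = "\<iota> (c i)" and z = 1 and u = "u ^ i"] small[of i] uO[of i]
      by (simp add: W.in_val_ring_iff)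
  qed simp
  ultimately have "W.vlt 1 (u ^ s * (\<iota> (c s) + u * q))" by simp
  then have P: "W.vlt 1 (\<iota> (c s) + u * q)"
    using W.vle_mult[OF W.vle_power[OF u(2), of s], of "\<iota> (c s) + u * q" 1] by auto
  define t where "t = inverse (c s)"
  have t: "t \<in> val_ring v"
    using V.vle_divide_iff[OF cs, of 1] s by (simp add: V.in_val_ring_iff t_def inverse_eq_divide)
  \<comment> \<open>Dividing by \<open>c s\<close> makes the constant term \<open>1\<close>, so that
    \<open>b = 1 - u z\<close> for the \<open>z\<close> below.\<close>
  define b where "b = \<iota> t * (\<iota> (c s) + u * q)"
  have bO: "b \<in> Osp H"
  proof -
    have "\<iota> (c s) * 1 + u * q \<in> Osp H"
      by (intro Osp_add Osp_scale order_mult[OF H] order_one[OF H] u c q)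
    then show ?thesis unfolding b_def using Osp_scale t by simp
  qed
  have b: "W.vlt 1 b"
    using W.vlt_mult[OF P, of 1 "\<iota> t"] t by (simp add: b_def V.in_val_ring_iff mult.commute)
  define z where "z = - (\<iota> t * q)"
  have z: "z \<in> Osp H" unfolding z_def by (intro Osp_uminus Osp_scale q t)
  have "\<iota> t * \<iota> (c s) = 1" using cs by (simp add: t_def flip: hom_mult)
  then have "1 + b * (-1) = u * z"
    by (simp add: b_def z_def algebra_simps)
  then have "V.vle (nrm u * nrm z) 1"
    using nrm_principal_units[OF H bO b, of "-1"] Osp_uminus[OF order_one[OF H]] by (simp add: nrm_mult)
  moreover have "V.vle (nrm u) (nrm u * nrm z)"
    using V.vle_mult_left[of 1 "nrm z" "nrm u"] nrm_order[OF H z] by (simp add: V.in_val_ring_iff)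
  ultimately show ?thesis using V.vle_trans by blast
qed

text \<open>For a primitive relation \<open>\<Sum> c\<^sub>i y\<^sup>i = 0\<close> the elements \<open>h\<^sub>j = \<Sum>\<^bsub>i \<ge> j\<^esub> c\<^sub>i y\<^bsup>i - j\<^esup>\<close> span
  the ring attached to the binary form with coefficients \<open>c\<^sub>i\<close>; it also contains all \<open>y h\<^sub>j\<close>,
  and some \<open>h\<^sub>j\<close> has value 0.\<close>

lemma nrm_unit_le:
  assumes y: "W.vle 1 y" "W.vle y 1"
  shows "V.vle (nrm y) 1"
proof -
  obtain d c k where c: "\<And>i. c i \<in> val_ring v" "\<And>i. d < i \<Longrightarrow> c i = 0" "k \<le> d" "c k = 1"
    and rel: "(\<Sum>i\<le>d. \<iota> (c i) * y ^ i) = 0"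
    by (rule exists_primitive_relation[of y]) blast
  define h where "h j = (\<Sum>i\<in>{j..d}. \<iota> (c i) * y ^ (i - j))" for j
  have h0: "h 0 = 0" using rel by (simp add: h_def atLeast0AtMost)
  have hrec: "h j = \<iota> (c j) + y * h (Suc j)" for j
  proof (cases "j \<le> d")
    case True
    have "(\<Sum>i\<in>{Suc j..d}. \<iota> (c i) * y ^ (i - j)) = y * h (Suc j)"
      unfolding h_def sum_distrib_left
    proof (intro sum.cong refl)
      fix i assume "i \<in> {Suc j..d}"
      then have "y ^ (i - j) = y * y ^ (i - Suc j)" by (simp add: Suc_diff_Suc flip: power_Suc)
      then show "\<iota> (c i) * y ^ (i - j) = y * (\<iota> (c i) * y ^ (i - Suc j))" by simp
    qed
    then show ?thesis using True by (simp add: h_def sum.atLeast_Suc_atMost)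
  qed (simp add: h_def c(2))
  define H where "H = insert 1 (h ` {..d})"
  have hH: "h j \<in> Osp H" for j
  proof (cases "j \<le> d")
    case True
    then show ?thesis by (intro Osp_base) (simp add: H_def)
  qed (simp add: h_def)
  have oneH: "1 \<in> Osp H" by (intro Osp_base) (simp add: H_def)
  have hh: "h i * h j \<in> Osp H" for i j
  proof (induction i arbitrary: j)
    case (Suc i)
    \<comment> \<open>Eliminating \<open>y\<close> from the recursions for \<open>h i\<close> and
      \<open>h j\<close> lowers the first index and raises the second; the induction ends at
      \<open>h 0 = 0\<close>.\<close>
    have "h (Suc i) * h j = h i * h (Suc j) + \<iota> (c j) * h (Suc i) - \<iota> (c i) * h (Suc j)"
      unfolding hrec[of i] hrec[of j] by (simp add: algebra_simps)
    then show ?case using Suc.IH[of "Suc j"] by (simp add: Osp_add Osp_diff Osp_scale hH c)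
  qed (simp add: h0)
  have "h j \<in> val_ring w" for j
    unfolding h_def using y(1)
    by (intro W.val_ring_sum W.val_ring_mult W.val_ring_power) (auto simp: c W.in_val_ring_iff[symmetric])
  then have H: "is_order H"
    unfolding is_order_def
  proof (intro conjI ballI)
    fix a b assume "a \<in> H" "b \<in> H"
    then consider "a = 1" | "b = 1" | i j where "a = h i" "b = h j" unfolding H_def by blast
    then show "a * b \<in> Osp H"
      by cases (use \<open>a \<in> H\<close> \<open>b \<in> H\<close> hh in \<open>simp_all add: Osp_base\<close>)
  qed (auto simp: H_def)
  \<comment> \<open>If all \<open>h j\<close> had positive value, so would
    \<open>c k = h k - y * h (Suc k)\<close>, which is \<open>1\<close>.\<close>
  have "\<exists>j. W.vle (h j) 1"
  proof (rule ccontr)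
    assume "\<nexists>j. W.vle (h j) 1"
    then have small: "W.vlt 1 (h j)" for j by blast
    have "W.vlt 1 (y * h (Suc k))"
      using W.vlt_mult[OF small[of "Suc k"], of 1 y] y(1) by (simp add: mult.commute)
    then have "W.vlt 1 (h k + - (y * h (Suc k)))"
      using small by (intro W.vlt_add) simp_all
    then show False using hrec[of k] c(4) by simp
  qed
  then obtain j where j: "W.vle (h j) 1" by blast
  then have "j \<noteq> 0" using h0 by (metis W.zero_vle_iff zero_neq_one)
  then obtain i where i: "j = Suc i" using not0_implies_Suc by blast
  \<comment> \<open>The point of the construction: \<open>y * h j\<close> lies in the order although
    \<open>y\<close> itself may not.\<close>
  have "y * h j = h i - \<iota> (c i) * 1" using hrec[of i] by (simp add: i)
  then have "y * h j \<in> Osp H" using Osp_diff[OF hH Osp_scale[OF oneH c(1)]] by metis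
  moreover have "W.vle (y * h j) 1" using W.vle_mult[OF y(2) j] by simp
  ultimately have "V.vle (nrm y * nrm (h j)) 1"
    using nrm_order_unit[OF H] by (simp flip: nrm_mult)
  moreover have "V.vle (nrm y) (nrm y * nrm (h j))"
    using V.vle_mult_left[of 1 "nrm (h j)" "nrm y"] nrm_order[OF H hH] by (simp add: V.in_val_ring_iff)
  ultimately show ?thesis using V.vle_trans by blast
qed

text \<open>The lower bound is the upper bound for \<open>inverse y\<close>.\<close>

lemma nrm_unit:
  assumes y: "W.vle 1 y" "W.vle y 1"
  shows "V.vle 1 (nrm y)" "V.vle (nrm y) 1"
proof -
  show "V.vle (nrm y) 1" by (rule nrm_unit_le[OF y])
  have "y \<noteq> 0" using y(2) by auto
  then have "W.vle 1 (inverse y)" "W.vle (inverse y) 1"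
    using W.vle_mult_right[OF y(1), of "inverse y"] W.vle_mult_right[OF y(2), of "inverse y"]
    by simp_all
  then have "V.vle (nrm (inverse y)) 1" by (rule nrm_unit_le)
  then have "V.vle (nrm y * nrm (inverse y)) (nrm y * 1)" by (rule V.vle_mult_left)
  then show "V.vle 1 (nrm y)" using nrm_inverse[OF \<open>y \<noteq> 0\<close>] by simp
qed

section \<open>Norms of arbitrary elements and the maximum principle for \<open>L\<close>\<close>

text \<open>In a vanishing sum of multiples of powers of \<open>y\<close>, two nonzero terms share
  the least value; \<open>k\<close> is the difference of their exponents.\<close>

lemma value_torsion:
  assumes "y \<noteq> 0"
  obtains k c where "0 < k" "c \<noteq> 0" "W.vle (y ^ k) (\<iota> c)" "W.vle (\<iota> c) (y ^ k)"
proof -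
  note result = that
  have *: thesis if "i < j" "c i \<noteq> 0" "c j \<noteq> 0"
    "W.vle (\<iota> (c i) * y ^ i) (\<iota> (c j) * y ^ j)" "W.vle (\<iota> (c j) * y ^ j) (\<iota> (c i) * y ^ i)"
    for i j :: nat and c
  proof (rule result)
    have eq: "\<iota> (c j) * y ^ j = (\<iota> (c j) * y ^ i) * y ^ (j - i)"
      "\<iota> (c i) * y ^ i = (\<iota> (c j) * y ^ i) * \<iota> (c i / c j)"
      using \<open>i < j\<close> \<open>c j \<noteq> 0\<close> by (simp_all add: hom_divide flip: power_add)
    have nz: "\<iota> (c j) * y ^ i \<noteq> 0" using assms \<open>c j \<noteq> 0\<close> by simp
    show "W.vle (y ^ (j - i)) (\<iota> (c i / c j))" "W.vle (\<iota> (c i / c j)) (y ^ (j - i))"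
      using that(4,5) unfolding eq W.vle_mult_left_cancel[OF nz] by blast+
  qed (use that in auto)
  obtain d c i where r: "i \<le> d" "c i \<noteq> 0" "(\<Sum>i\<le>d. \<iota> (c i) * y ^ i) = 0"
    by (rule exists_algebraic_relation[of y])
  define I where "I = {i. i \<le> d \<and> c i \<noteq> 0}"
  have I: "finite I" "I \<noteq> {}" using r(1,2) by (auto simp: I_def)
  obtain k where k: "k \<in> I" "\<And>j. j \<in> I \<Longrightarrow> W.vle (\<iota> (c k) * y ^ k) (\<iota> (c j) * y ^ j)"
    using W.exists_vle_min[OF I, of "\<lambda>i. \<iota> (c i) * y ^ i"] by blast
  have nz: "\<iota> (c k) * y ^ k \<noteq> 0" using k(1) assms by (simp add: I_def)
  have "(\<Sum>i\<in>I. \<iota> (c i) * y ^ i) = (\<Sum>i\<le>d. \<iota> (c i) * y ^ i)"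
    by (intro sum.mono_neutral_left) (auto simp: I_def)
  then have "\<iota> (c k) * y ^ k = - (\<Sum>i\<in>I - {k}. \<iota> (c i) * y ^ i)"
    using r(3) sum.remove[OF I(1) k(1), of "\<lambda>i. \<iota> (c i) * y ^ i"]
    by (simp add: eq_neg_iff_add_eq_0)
  then have "\<not> W.vlt (\<iota> (c k) * y ^ k) (\<Sum>i\<in>I - {k}. \<iota> (c i) * y ^ i)"
    using W.vle_uminus by (metis W.vle_refl)
  then obtain j where j: "j \<in> I" "j \<noteq> k" "W.vle (\<iota> (c j) * y ^ j) (\<iota> (c k) * y ^ k)"
    using W.vlt_sum[OF nz, of "I - {k}" "\<lambda>i. \<iota> (c i) * y ^ i"] by blast
  show thesis
  proof (cases "j < k")
    case True
    show thesis by (rule *[of j k c]) (use True j k(1) k(2)[OF j(1)] in \<open>simp_all add: I_def\<close>)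
  next
    case False
    show thesis by (rule *[of k j c]) (use False j k(1) k(2)[OF j(1)] in \<open>simp_all add: I_def\<close>)
  qed
qed

text \<open>Write \<open>y ^ k = z * \<iota> c\<close> with \<open>z\<close> of value 0. The claim
  holds for \<open>z\<close> by \<open>nrm_unit\<close> and for \<open>\<iota> c\<close> by
  \<open>nrm_hom\<close>; \<open>W.vle_power_iff\<close> cancels the exponent
  \<open>k\<close>.\<close>

theorem nrm_value: "W.vle (\<iota> (nrm y)) (y ^ deg)" "W.vle (y ^ deg) (\<iota> (nrm y))"
proof -
  have "W.vle (\<iota> (nrm y)) (y ^ deg) \<and> W.vle (y ^ deg) (\<iota> (nrm y))"
  proof (cases "y = 0")
    case True
    then show ?thesis using deg_pos by (simp add: power_0_left)
  next
    case False
    obtain k c where k: "0 < k" and c: "c \<noteq> 0"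
      and yc: "W.vle (y ^ k) (\<iota> c)" "W.vle (\<iota> c) (y ^ k)"
      by (rule value_torsion[OF False])
    define z where "z = y ^ k * \<iota> (inverse c)"
    have yk: "y ^ k = z * \<iota> c" using c by (simp add: z_def hom_inverse)
    have ic: "\<iota> c \<noteq> 0" using c by simp
    have z: "W.vle 1 z" "W.vle z 1"
      using yc W.vle_mult_right_cancel[OF ic, of 1 z] W.vle_mult_right_cancel[OF ic, of z 1]
      by (simp_all add: yk)
    have n: "nrm y ^ k = nrm z * c ^ deg"
      using arg_cong[OF yk, of nrm] by (simp add: nrm_power nrm_mult nrm_hom)
    have d: "(y ^ deg) ^ k = z ^ deg * \<iota> c ^ deg"
      using arg_cong[OF yk, of "\<lambda>x. x ^ deg"] by (simp add: power_mult_distrib mult.commute flip: power_mult)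
    have "W.vle (\<iota> (nrm z)) (z ^ deg)" "W.vle (z ^ deg) (\<iota> (nrm z))"
      using nrm_unit[OF z] W.vle_power[OF z(1), of deg] W.vle_power[OF z(2), of deg]
        W.vle_trans[of "\<iota> (nrm z)" 1 "z ^ deg"] W.vle_trans[of "z ^ deg" 1 "\<iota> (nrm z)"]
      by simp_all
    then have "W.vle (\<iota> (nrm y) ^ k) ((y ^ deg) ^ k)" "W.vle ((y ^ deg) ^ k) (\<iota> (nrm y) ^ k)"
      unfolding d by (simp_all add: n hom_mult hom_power W.vle_mult_right flip: hom_power)
    then show ?thesis using W.vle_power_iff[OF k] by blast
  qed
  then show "W.vle (\<iota> (nrm y)) (y ^ deg)" "W.vle (y ^ deg) (\<iota> (nrm y))" by blast+
qed

lemma nrm_vle_iff: "V.vle (nrm x) (nrm y) \<longleftrightarrow> W.vle x y"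
proof -
  have "W.vle (\<iota> (nrm x)) (\<iota> (nrm y)) \<longleftrightarrow> W.vle (x ^ deg) (y ^ deg)"
    using nrm_value W.vle_trans by meson
  then show ?thesis using W.vle_power_iff[OF deg_pos] by simp
qed

text \<open>The norm of \<open>Q\<close> is polynomial over \<open>K\<close>, and \<open>nrm\<close>
  reflects the order of values, so a maximum of the norm is one of \<open>Q\<close>.\<close>

lemma polyfun_ext_max:
  assumes "finite I" "Q \<in> polyfun \<iota> I"
  obtains a where "\<And>i. i \<in> I \<Longrightarrow> a i \<in> val_ring v"
    "\<And>b. (\<And>i. i \<in> I \<Longrightarrow> b i \<in> val_ring v) \<Longrightarrow> W.vle (Q b) (Q a)"
  using V.polyfun_max[OF assms(1) polyfun_nrm[OF assms(2)]] unfolding nrm_vle_iff by blast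

end

section \<open>Orthogonal bases and extremality of the extension\<close>

lemma mpoly_eval_cong:
  assumes "mpoly_in_vars n F" "\<And>i. i < n \<Longrightarrow> a i = b i"
  shows "mpoly_eval F a = mpoly_eval F b"
  unfolding mpoly_eval_def
proof (intro sum.cong refl arg_cong2[of _ _ _ _ "(*)"] prod.cong)
  fix m i assume "m \<in> Poly_Mapping.keys F" "i \<in> Poly_Mapping.keys m"
  then have "i < n" using assms(1) unfolding mpoly_in_vars_def by blast
  then show "a i ^ Poly_Mapping.lookup m i = b i ^ Poly_Mapping.lookup m i" by (simp add: assms(2))
qed

context extremal_extension
begin

section \<open>Valuation-independent families and best approximation\<close>

text \<open>Valuation independence: together with \<open>W.vle_sum\<close> it says that the value of
  a combination is the least value of its terms.\<close>

definition orthogonal :: "'i set \<Rightarrow> ('i \<Rightarrow> 'b) \<Rightarrow> bool" where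
  "orthogonal I d \<longleftrightarrow> finite I \<and> (\<forall>i\<in>I. d i \<noteq> 0) \<and>
    (\<forall>c. \<forall>i\<in>I. W.vle (\<Sum>i\<in>I. \<iota> (c i) * d i) (\<iota> (c i) * d i))"

lemma orthogonal_coeff_0:
  assumes "orthogonal I d" "(\<Sum>i\<in>I. \<iota> (c i) * d i) = 0" "i \<in> I"
  shows "c i = 0"
proof -
  have "W.vle 0 (\<iota> (c i) * d i)" using assms unfolding orthogonal_def by metis
  then show ?thesis using assms unfolding orthogonal_def by auto
qed

lemma orthogonal_inj:
  assumes "orthogonal I d"
  shows "inj_on d I"
proof (rule inj_onI, rule ccontr)
  fix i j assume ij: "i \<in> I" "j \<in> I" "d i = d j" "i \<noteq> j"
  define c :: "_ \<Rightarrow> 'a" where "c k = (if k = i then 1 else if k = j then -1 else 0)" for k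
  have "(\<Sum>k\<in>I. \<iota> (c k) * d k) = (\<Sum>k\<in>{i, j}. \<iota> (c k) * d k)"
    using assms ij by (intro sum.mono_neutral_right) (auto simp: c_def orthogonal_def)
  also have "\<dots> = 0" using ij by (simp add: c_def)
  finally have "c i = 0" using orthogonal_coeff_0[OF assms] ij by blast
  then show False by (simp add: c_def)
qed

lemma orthogonal_independent:
  assumes "orthogonal I d"
  shows "vs.independent (d ` I)"
proof
  have fin: "finite (d ` I)" using assms by (simp add: orthogonal_def)
  assume "vs.dependent (d ` I)"
  then obtain u i where "i \<in> I" "u (d i) \<noteq> 0" "(\<Sum>b\<in>d ` I. \<iota> (u b) * b) = 0"
    unfolding vs.dependent_finite[OF fin] by blast
  then show False
    using orthogonal_coeff_0[OF assms, of "\<lambda>i. u (d i)"]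
    by (simp add: sum.reindex[OF orthogonal_inj[OF assms]])
qed

lemma orthogonal_card_le: "orthogonal I d \<Longrightarrow> card I \<le> deg"
  using independent_finite_card(2)[OF orthogonal_independent] card_image[OF orthogonal_inj] by metis

lemma orthogonal_card_eq:
  assumes "orthogonal I d" "\<And>y. \<exists>c. y = (\<Sum>i\<in>I. \<iota> (c i) * d i)"
  shows "card I = deg"
proof -
  have "y \<in> vs.span (d ` I)" for y
  proof -
    obtain c where c: "y = (\<Sum>i\<in>I. \<iota> (c i) * d i)" using assms(2) by blast
    show ?thesis unfolding c by (intro vs.span_sum vs.span_scale vs.span_base imageI)
  qed
  then have "card (d ` I) = deg"
    using card_basis[OF orthogonal_independent[OF assms(1)]] by blast
  then show ?thesis using card_image[OF orthogonal_inj[OF assms(1)]] by metis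
qed

lemma exists_small_scalar:
  assumes "finite D" "0 \<notin> D"
  obtains c where "c \<noteq> 0" "\<And>y. y \<in> D \<Longrightarrow> W.vle (\<iota> c) y"
proof -
  \<comment> \<open>Inserting \<open>1\<close> makes the least value at most 0, so that the value of
    \<open>y ^ k\<close> is no larger than that of \<open>y\<close>.\<close>
  have ins: "finite (insert 1 D)" "insert 1 D \<noteq> {}" using assms(1) by auto
  obtain y where y: "y \<in> insert 1 D" "\<And>x. x \<in> insert 1 D \<Longrightarrow> W.vle y x"
    using W.exists_vle_min[OF ins, of "\<lambda>x. x"] by blast
  have "y \<noteq> 0" using y(1) assms(2) by auto
  then obtain k c where k: "0 < k" "c \<noteq> 0" "W.vle (\<iota> c) (y ^ k)"
    by (rule value_torsion)
  have "W.vle (y * y ^ (k - 1)) (y * 1)"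
    using W.vle_power[of y 1 "k - 1"] y(2)[of 1] by (intro W.vle_mult_left) simp
  then have "W.vle (y ^ k) y" using k(1) by (cases k) simp_all
  then have cy: "W.vle (\<iota> c) y" by (rule W.vle_trans[OF k(3)])
  show ?thesis by (rule that[OF k(2)]) (use y(2) in \<open>blast intro: W.vle_trans[OF cy]\<close>)
qed

text \<open>A combination that improves on \<open>0\<close> has value at least that of
  \<open>a\<close>. Orthogonality then bounds its coefficients, and after rescaling by
  \<open>C\<close> the maximum is taken over a power of the valuation ring.\<close>

lemma orthogonal_best_approx:
  assumes d: "orthogonal I d"
  obtains c where "\<And>c'. W.vle (a - (\<Sum>i\<in>I. \<iota> (c' i) * d i)) (a - (\<Sum>i\<in>I. \<iota> (c i) * d i))"
proof (cases "a = 0")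
  case True
  show ?thesis by (rule that[of "\<lambda>_. 0"]) (simp add: True)
next
  case False
  have I: "finite I" "\<And>i. i \<in> I \<Longrightarrow> d i \<noteq> 0" using d by (auto simp: orthogonal_def)
  have "finite ((\<lambda>i. a / d i) ` I)" "0 \<notin> (\<lambda>i. a / d i) ` I" using I False by auto
  then obtain C where C: "C \<noteq> 0" "\<And>y. y \<in> (\<lambda>i. a / d i) ` I \<Longrightarrow> W.vle (\<iota> C) y"
    by (rule exists_small_scalar) blast
  define Q where "Q x = a - (\<Sum>i\<in>I. (\<iota> C * \<iota> (x i)) * d i)" for x
  have "Q \<in> polyfun \<iota> I"
    unfolding Q_def by (intro polyfun_diff polyfun_sum polyfun.mult polyfun.const polyfun.var)
  then obtain x where x: "\<And>i. i \<in> I \<Longrightarrow> x i \<in> val_ring v"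
    "\<And>x'. (\<And>i. i \<in> I \<Longrightarrow> x' i \<in> val_ring v) \<Longrightarrow> W.vle (Q x') (Q x)"
    using polyfun_ext_max[OF I(1)] by blast
  show ?thesis
  proof (rule that[of "\<lambda>i. C * x i"])
    fix c'
    define s where "s = (\<Sum>i\<in>I. \<iota> (c' i) * d i)"
    have Qx: "Q x = a - (\<Sum>i\<in>I. \<iota> (C * x i) * d i)" by (simp add: Q_def hom_mult)
    have "W.vle (a - s) (Q x)"
    proof (cases "W.vle (a - s) a")
      case True
      moreover have "W.vle a (Q x)" using x(2)[of "\<lambda>_. 0"] by (simp add: Q_def)
      ultimately show ?thesis using W.vle_trans by blast
    next
      case False
      then have "W.vle a (a - (a - s))" using W.vle_diff[OF W.vle_refl W.vlt_imp_vle] by blast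
      then have as: "W.vle a s" by simp
      have "c' i / C \<in> val_ring v" if "i \<in> I" for i
      proof -
        have "W.vle s (\<iota> (c' i) * d i)" using d that unfolding orthogonal_def s_def by blast
        with as have "W.vle a (\<iota> (c' i) * d i)" using W.vle_trans by blast
        then have "W.vle (a / d i * d i) (\<iota> (c' i) * d i)" using I(2)[OF that] by simp
        then have "W.vle (a / d i) (\<iota> (c' i))"
          using W.vle_mult_right_cancel[OF I(2)[OF that]] by blast
        then have "V.vle C (c' i)" using C(2)[OF imageI[OF that]] W.vle_trans vle_hom by blast
        then show ?thesis using V.vle_divide_iff[OF C(1)] by (simp add: V.in_val_ring_iff)
      qed
      moreover have "Q (\<lambda>i. c' i / C) = a - s"
        using C(1) by (simp add: Q_def s_def flip: hom_mult)
      ultimately show ?thesis using x(2)[of "\<lambda>i. c' i / C"] by simp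
    qed
    then show "W.vle (a - s) (a - (\<Sum>i\<in>I. \<iota> (C * x i) * d i))" by (simp add: Qx)
  qed
qed

section \<open>Residual independence and value independence\<close>

definition residually_independent :: "'b set \<Rightarrow> bool" where
  "residually_independent B \<longleftrightarrow> finite B \<and> B \<subseteq> val_ring w \<and>
    (\<forall>c. (\<forall>b\<in>B. c b \<in> val_ring v) \<longrightarrow> residually_zero w (\<Sum>b\<in>B. \<iota> (c b) * b) \<longrightarrow>
      (\<forall>b\<in>B. residually_zero v (c b)))"

lemma residually_independentD:
  assumes "residually_independent B" "\<And>b. b \<in> B \<Longrightarrow> c b \<in> val_ring v"
    "W.vlt 1 (\<Sum>b\<in>B. \<iota> (c b) * b)" "b \<in> B"
  shows "V.vlt 1 (c b)"
  using assms unfolding residually_independent_def V.residually_zero_iff W.residually_zero_iff by blast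

text \<open>After division by a coefficient \<open>x\<close> of least value the residues combine
  nontrivially, so the quotient has value 0.\<close>

lemma residually_independent_sum:
  assumes B: "residually_independent B" and b1: "b1 \<in> B" "c b1 \<noteq> 0"
  obtains x where "x \<noteq> 0" "W.vle (\<iota> x) (\<Sum>b\<in>B. \<iota> (c b) * b)"
    "W.vle (\<Sum>b\<in>B. \<iota> (c b) * b) (\<iota> x)" "\<And>b. b \<in> B \<Longrightarrow> V.vle x (c b)"
proof -
  have fin: "finite B" "B \<noteq> {}" and BO: "B \<subseteq> val_ring w"
    using B b1 by (auto simp: residually_independent_def)
  obtain b0 where b0: "b0 \<in> B" "\<And>b. b \<in> B \<Longrightarrow> V.vle (c b0) (c b)"
    using V.exists_vle_min[OF fin, of c] by blast
  have nz: "c b0 \<noteq> 0" using b0(2)[OF b1(1)] b1(2) by auto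
  have "c b / c b0 \<in> val_ring v" if "b \<in> B" for b
    using b0(2)[OF that] V.vle_divide_iff[OF nz] by (simp add: V.in_val_ring_iff)
  moreover have "\<not> V.vlt 1 (c b0 / c b0)" using nz by simp
  ultimately have "W.vle (\<Sum>b\<in>B. \<iota> (c b / c b0) * b) 1"
    using residually_independentD[OF B, of "\<lambda>b. c b / c b0"] b0(1) by blast
  then have "W.vle (\<iota> (c b0) * (\<Sum>b\<in>B. \<iota> (c b / c b0) * b)) (\<iota> (c b0) * 1)"
    by (rule W.vle_mult_left)
  moreover have "\<iota> (c b0) * (\<iota> (c b / c b0) * b) = \<iota> (c b) * b" for b
    using nz by (simp add: mult.assoc[symmetric] flip: hom_mult)
  ultimately have le: "W.vle (\<Sum>b\<in>B. \<iota> (c b) * b) (\<iota> (c b0))"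
    by (simp add: sum_distrib_left)
  have "W.vle (\<iota> (c b0)) (\<Sum>b\<in>B. \<iota> (c b) * b)"
  proof (rule W.vle_sum)
    fix b assume "b \<in> B"
    then have "W.vle (\<iota> (c b0) * 1) (\<iota> (c b) * b)"
      using b0(2) BO by (intro W.vle_mult) (auto simp: W.in_val_ring_iff)
    then show "W.vle (\<iota> (c b0)) (\<iota> (c b) * b)" by simp
  qed
  with nz le b0(2) show ?thesis using that by blast
qed

lemma residually_independent_unit:
  assumes B: "residually_independent B" and b: "b \<in> B"
  shows "W.vle b 1"
proof (rule ccontr)
  assume "W.vlt 1 b"
  have fin: "finite B" using B by (simp add: residually_independent_def)
  have "(\<Sum>b'\<in>B. \<iota> (if b' = b then 1 else 0) * b') = (\<Sum>b'\<in>B. if b' = b then b' else 0)"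
    by (intro sum.cong) auto
  then have "(\<Sum>b'\<in>B. \<iota> (if b' = b then 1 else 0) * b') = b" using fin b by simp
  then have "V.vlt 1 ((\<lambda>b'. if b' = b then 1 else 0) b)"
    using b \<open>W.vlt 1 b\<close> by (intro residually_independentD[OF B]) auto
  then show False by simp
qed

text \<open>The values of the elements of \<open>R\<close> lie in distinct cosets of the value group
  of \<open>K\<close>.\<close>

definition value_independent :: "'b set \<Rightarrow> bool" where
  "value_independent R \<longleftrightarrow> finite R \<and> 0 \<notin> R \<and>
    (\<forall>r\<in>R. \<forall>r'\<in>R. \<forall>x. W.vle r' (\<iota> x * r) \<longrightarrow> W.vle (\<iota> x * r) r' \<longrightarrow> r = r')"

text \<open>Nonzero terms have values in distinct cosets, hence distinct values, so the term of
  least value determines the value of the sum.\<close>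

lemma value_independent_sum:
  assumes R: "value_independent R"
    and z: "\<And>r. r \<in> R \<Longrightarrow> z r \<noteq> 0 \<Longrightarrow> \<exists>x. x \<noteq> 0 \<and> W.vle (z r) (\<iota> x * r) \<and> W.vle (\<iota> x * r) (z r)"
    and "r \<in> R"
  shows "W.vle (\<Sum>r\<in>R. z r) (z r)"
proof -
  have fin: "finite R" "R \<noteq> {}" using R \<open>r \<in> R\<close> by (auto simp: value_independent_def)
  obtain r0 where r0: "r0 \<in> R" "\<And>r. r \<in> R \<Longrightarrow> W.vle (z r0) (z r)"
    using W.exists_vle_min[OF fin, of z] by blast
  have "W.vle (\<Sum>r\<in>R. z r) (z r0)"
  proof (cases "z r0 = 0")
    case False
    obtain x0 where x0: "x0 \<noteq> 0" "W.vle (z r0) (\<iota> x0 * r0)" "W.vle (\<iota> x0 * r0) (z r0)"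
      using z[OF r0(1) False] by blast
    have "W.vlt (z r0) (z r)" if r: "r \<in> R - {r0}" for r
    proof
      assume le: "W.vle (z r) (z r0)"
      then have "z r \<noteq> 0" using False by auto
      then obtain x where x: "x \<noteq> 0" "W.vle (z r) (\<iota> x * r)" "W.vle (\<iota> x * r) (z r)"
        using z r by blast
      have eq: "\<iota> x0 * r0 = \<iota> x * (\<iota> (x0 / x) * r0)"
        using x(1) by (simp add: mult.assoc[symmetric] flip: hom_mult)
      have nz: "\<iota> x \<noteq> 0" using x(1) by simp
      have "W.vle (\<iota> x * r) (\<iota> x * (\<iota> (x0 / x) * r0))"
        using x(3) le x0(2) unfolding eq[symmetric] by (meson W.vle_trans)
      moreover have "W.vle (\<iota> x * (\<iota> (x0 / x) * r0)) (\<iota> x * r)"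
        using x0(3) r0(2)[of r] r x(2) unfolding eq[symmetric] by (meson W.vle_trans DiffD1)
      ultimately have "r0 = r"
        using R r r0(1) unfolding W.vle_mult_left_cancel[OF nz] value_independent_def by blast
      then show False using r by blast
    qed
    then have "W.vlt (z r0) (\<Sum>r\<in>R - {r0}. z r)" by (intro W.vlt_sum False)
    then have "W.vle (z r0 + (\<Sum>r\<in>R - {r0}. z r)) (z r0)" by (rule W.vle_add_vlt)
    then show ?thesis by (simp add: sum.remove[OF fin(1) r0(1)])
  qed simp
  then show ?thesis using r0(2)[OF \<open>r \<in> R\<close>] W.vle_trans by blast
qed

text \<open>For fixed \<open>r\<close>, a nonzero combination over \<open>B\<close> has a value from
  \<open>K\<close>, so times \<open>r\<close> its value lies in the coset of \<open>r\<close>; terms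
  for different \<open>r\<close> cannot cancel.\<close>

lemma orthogonal_product:
  assumes R: "value_independent R" and B: "residually_independent B"
  shows "orthogonal (R \<times> B) (\<lambda>(r, b). r * b)"
  unfolding orthogonal_def
proof (intro conjI allI ballI)
  have finB: "finite B" and BO: "B \<subseteq> val_ring w" using B by (auto simp: residually_independent_def)
  show "finite (R \<times> B)" using R finB by (simp add: value_independent_def)
  have "0 \<notin> B" using residually_independent_unit[OF B, of 0] by auto
  then show "(case i of (r, b) \<Rightarrow> r * b) \<noteq> 0" if "i \<in> R \<times> B" for i
    using that R unfolding value_independent_def by (auto split: prod.splits)
  fix c :: "'b \<times> 'b \<Rightarrow> 'a" and i assume "i \<in> R \<times> B"
  then obtain r b where i: "i = (r, b)" "r \<in> R" "b \<in> B" by blast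
  define z where "z r = (\<Sum>b\<in>B. \<iota> (c (r, b)) * b) * r" for r
  have sum: "(\<Sum>i\<in>R \<times> B. \<iota> (c i) * (case i of (r, b) \<Rightarrow> r * b)) = (\<Sum>r\<in>R. z r)"
    unfolding z_def sum.cartesian_product' sum_distrib_right by (simp add: algebra_simps)
  have "W.vle (\<Sum>r\<in>R. z r) (z r)"
  proof (rule value_independent_sum[OF R _ i(2)])
    fix r assume "r \<in> R" "z r \<noteq> 0"
    have "\<not> (\<forall>b\<in>B. c (r, b) = 0)"
    proof
      assume "\<forall>b\<in>B. c (r, b) = 0"
      then have "(\<Sum>b\<in>B. \<iota> (c (r, b)) * b) = 0" by (intro sum.neutral) simp
      with \<open>z r \<noteq> 0\<close> show False by (simp add: z_def)
    qed
    then obtain b1 where "b1 \<in> B" "c (r, b1) \<noteq> 0" by blast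
    then obtain x where "x \<noteq> 0" "W.vle (\<iota> x) (\<Sum>b\<in>B. \<iota> (c (r, b)) * b)"
      "W.vle (\<Sum>b\<in>B. \<iota> (c (r, b)) * b) (\<iota> x)"
      by (rule residually_independent_sum[OF B, of _ "\<lambda>b. c (r, b)"]) blast
    then show "\<exists>x. x \<noteq> 0 \<and> W.vle (z r) (\<iota> x * r) \<and> W.vle (\<iota> x * r) (z r)"
      unfolding z_def using W.vle_mult_right by blast
  qed
  also have "W.vle (z r) (\<iota> (c (r, b)) * r)"
  proof (cases "c (r, b) = 0")
    case False
    then obtain x where "W.vle (\<Sum>b\<in>B. \<iota> (c (r, b)) * b) (\<iota> x)" "V.vle x (c (r, b))"
      using residually_independent_sum[OF B i(3), of "\<lambda>b. c (r, b)"] i(3) by blast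
    then show ?thesis unfolding z_def by (intro W.vle_mult_right) (meson W.vle_trans vle_hom)
  qed simp
  also have "W.vle (\<iota> (c (r, b)) * r) (\<iota> (c (r, b)) * r * b)"
    using W.vle_mult_left[of 1 b "\<iota> (c (r, b)) * r"] BO i(3) by (auto simp: W.in_val_ring_iff)
  finally show "W.vle (\<Sum>i\<in>R \<times> B. \<iota> (c i) * (case i of (r, b) \<Rightarrow> r * b))
      (\<iota> (c i) * (case i of (r, b) \<Rightarrow> r * b))"
    unfolding sum by (simp add: i(1) mult.assoc)
qed

lemma residually_independent_card_le:
  assumes B: "residually_independent B"
  shows "card B \<le> deg"
proof -
  have "value_independent {1}" by (simp add: value_independent_def)
  from orthogonal_card_le[OF orthogonal_product[OF this B]] show ?thesis
    by (simp add: card_cartesian_product)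
qed

lemma value_independent_card_le:
  assumes R: "value_independent R"
  shows "card R \<le> deg"
proof -
  have "residually_independent {1}"
    by (simp add: residually_independent_def V.residually_zero_iff W.residually_zero_iff)
  from orthogonal_card_le[OF orthogonal_product[OF R this]] show ?thesis
    by (simp add: card_cartesian_product)
qed

text \<open>Two elements with the same residue would give a forbidden relation with coefficients
  \<open>1\<close> and \<open>-1\<close>, whence the injectivity clause.\<close>

lemma residue_basis_iff:
  "residue_basis v \<iota> w B \<longleftrightarrow> residually_independent B \<and>
    (\<forall>y \<in> val_ring w. \<exists>c. (\<forall>b\<in>B. c b \<in> val_ring v) \<and>
      residually_zero w (y - (\<Sum>b\<in>B. \<iota> (c b) * b)))"
proof -
  have "inj_on (\<lambda>b. {y \<in> val_ring w. residually_zero w (y - b)}) B"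
    if B: "residually_independent B"
  proof (rule inj_onI, rule ccontr)
    fix b b' assume b: "b \<in> B" "b' \<in> B" "b \<noteq> b'"
      and eq: "{y \<in> val_ring w. residually_zero w (y - b)} = {y \<in> val_ring w. residually_zero w (y - b')}"
    have fin: "finite B" and BO: "B \<subseteq> val_ring w" using B by (auto simp: residually_independent_def)
    have "b \<in> {y \<in> val_ring w. residually_zero w (y - b)}"
      using BO b(1) by (auto simp: W.residually_zero_iff)
    then have "residually_zero w (b - b')" using eq by blast
    then have small: "W.vlt 1 (b - b')" by (simp add: W.residually_zero_iff)
    define c :: "'b \<Rightarrow> 'a" where "c k = (if k = b then 1 else if k = b' then -1 else 0)" for k
    have "(\<Sum>k\<in>B. \<iota> (c k) * k) = (\<Sum>k\<in>{b, b'}. \<iota> (c k) * k)"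
      using fin b by (intro sum.mono_neutral_right) (auto simp: c_def)
    also have "\<dots> = b - b'" using b by (simp add: c_def)
    finally have "V.vlt 1 (c b)"
      using small b(1) by (intro residually_independentD[OF B]) (auto simp: c_def)
    then show False by (simp add: c_def)
  qed
  then show ?thesis unfolding residue_basis_def residually_independent_def by blast
qed

text \<open>A residually independent set of largest size exists because sizes are bounded by
  \<open>deg\<close>, and such a set spans.\<close>

lemma exists_residue_basis: "\<exists>B. residue_basis v \<iota> w B"
proof -
  have "residually_independent {}" by (simp add: residually_independent_def)
  moreover have "\<forall>B. residually_independent B \<longrightarrow> card B < Suc deg"
    using residually_independent_card_le by (simp add: less_Suc_eq_le)
  ultimately have "\<exists>B. residually_independent B \<and>
      (\<forall>B'. residually_independent B' \<longrightarrow> card B' \<le> card B)"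
    by (rule ex_has_greatest_nat)
  then obtain B where B: "residually_independent B"
    and max: "\<And>B'. residually_independent B' \<Longrightarrow> card B' \<le> card B" by blast
  have fin: "finite B" and BO: "B \<subseteq> val_ring w" using B by (auto simp: residually_independent_def)
  have "\<exists>c. (\<forall>b\<in>B. c b \<in> val_ring v) \<and> residually_zero w (y - (\<Sum>b\<in>B. \<iota> (c b) * b))"
    if y: "y \<in> val_ring w" for y
  proof (rule ccontr)
    assume no: "\<nexists>c. (\<forall>b\<in>B. c b \<in> val_ring v) \<and> residually_zero w (y - (\<Sum>b\<in>B. \<iota> (c b) * b))"
    have yB: "y \<notin> B"
    proof
      assume "y \<in> B"
      have "(\<Sum>b\<in>B. \<iota> (if b = y then 1 else 0) * b) = (\<Sum>b\<in>B. if b = y then b else 0)"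
        by (intro sum.cong) auto
      then have "y - (\<Sum>b\<in>B. \<iota> (if b = y then 1 else 0) * b) = 0" using fin \<open>y \<in> B\<close> by simp
      then show False
        using no by (elim notE, intro exI[of _ "\<lambda>b. if b = y then 1 else 0"])
          (auto simp: W.residually_zero_iff)
    qed
    have "residually_independent (insert y B)"
      unfolding residually_independent_def
    proof (intro conjI allI impI)
      fix c assume c: "\<forall>b\<in>insert y B. c b \<in> val_ring v"
        and "residually_zero w (\<Sum>b\<in>insert y B. \<iota> (c b) * b)"
      then have small: "W.vlt 1 (\<iota> (c y) * y + (\<Sum>b\<in>B. \<iota> (c b) * b))"
        using fin yB by (simp add: W.residually_zero_iff)
      have cy: "V.vlt 1 (c y)"
      proof
        \<comment> \<open>With \<open>c y\<close> invertible, solving the relation for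
          \<open>y\<close> would approximate it residually by \<open>B\<close>.\<close>
        assume le: "V.vle (c y) 1"
        then have nz: "c y \<noteq> 0" by auto
        have inv: "V.vle 1 (inverse (c y))"
          using V.vle_divide_iff[OF nz, of 1] le by (simp add: inverse_eq_divide)
        define c' where "c' b = - (inverse (c y) * c b)" for b
        have c'b: "\<iota> (c' b) * b = - (\<iota> (inverse (c y)) * (\<iota> (c b) * b))" for b
          by (simp add: c'_def hom_mult)
        have one: "\<iota> (c y) * \<iota> (inverse (c y)) = 1" using nz by (simp flip: hom_mult)
        have "(\<iota> (c y) * y + s) * \<iota> (inverse (c y)) =
            (\<iota> (c y) * \<iota> (inverse (c y))) * y + \<iota> (inverse (c y)) * s" for s
          by (simp only: algebra_simps)
        then have "y - (\<Sum>b\<in>B. \<iota> (c' b) * b) =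
            (\<iota> (c y) * y + (\<Sum>b\<in>B. \<iota> (c b) * b)) * \<iota> (inverse (c y))"
          unfolding c'b sum_negf sum_distrib_left[symmetric] one by simp
        moreover have "W.vlt (1 * 1) ((\<iota> (c y) * y + (\<Sum>b\<in>B. \<iota> (c b) * b)) * \<iota> (inverse (c y)))"
          using small inv by (intro W.vlt_mult) simp_all
        ultimately have "residually_zero w (y - (\<Sum>b\<in>B. \<iota> (c' b) * b))"
          by (simp add: W.residually_zero_iff)
        moreover have "\<forall>b\<in>B. c' b \<in> val_ring v"
          using c inv by (auto simp: c'_def V.in_val_ring_iff[symmetric] intro: V.val_ring_mult)
        ultimately show False using no by blast
      qed
      then have "W.vlt (1 * 1) (\<iota> (c y) * y)"
        using y by (intro W.vlt_mult) (simp_all add: W.in_val_ring_iff)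
      then have "W.vlt 1 ((\<iota> (c y) * y + (\<Sum>b\<in>B. \<iota> (c b) * b)) + - (\<iota> (c y) * y))"
        using small by (intro W.vlt_add[OF small]) simp
      then have "W.vlt 1 (\<Sum>b\<in>B. \<iota> (c b) * b)" by simp
      then show "\<forall>b\<in>insert y B. residually_zero v (c b)"
        using residually_independentD[OF B] c cy by (simp add: V.residually_zero_iff)
    qed (use fin BO y in auto)
    from max[OF this] show False using fin yB by simp
  qed
  with B show ?thesis unfolding residue_basis_iff by blast
qed

section \<open>Spanning and the fundamental equality\<close>

text \<open>A best approximation with error \<open>a' \<noteq> 0\<close> could be improved:
  \<open>a'\<close> has the value of some \<open>s = \<iota> x * r\<close>, and approximating
  \<open>a' / s\<close> residually by \<open>B\<close> leaves an error of larger value.\<close>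

lemma product_spanning:
  assumes R: "value_independent R" and B: "residue_basis v \<iota> w B"
    and full: "\<And>y. y \<noteq> 0 \<Longrightarrow> \<exists>r\<in>R. \<exists>x. W.vle y (\<iota> x * r) \<and> W.vle (\<iota> x * r) y"
  shows "\<exists>c. a = (\<Sum>i\<in>R \<times> B. \<iota> (c i) * (case i of (r, b) \<Rightarrow> r * b))"
proof -
  let ?d = "\<lambda>(r, b). r * b"
  have B': "residually_independent B" using B residue_basis_iff by blast
  have fin: "finite R" "finite B" using R B' by (auto simp: value_independent_def residually_independent_def)
  obtain c where c: "\<And>c'. W.vle (a - (\<Sum>i\<in>R \<times> B. \<iota> (c' i) * ?d i)) (a - (\<Sum>i\<in>R \<times> B. \<iota> (c i) * ?d i))"
    by (rule orthogonal_best_approx[OF orthogonal_product[OF R B'], of a]) blast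
  define a' where "a' = a - (\<Sum>i\<in>R \<times> B. \<iota> (c i) * ?d i)"
  have "a' = 0"
  proof (rule ccontr)
    assume a': "a' \<noteq> 0"
    then obtain r x where r: "r \<in> R" and x: "W.vle a' (\<iota> x * r)" "W.vle (\<iota> x * r) a'"
      using full by blast
    define s where "s = \<iota> x * r"
    have s: "s \<noteq> 0" using x(2) a' W.zero_vle_iff unfolding s_def[symmetric] by blast
    have "a' / s \<in> val_ring w"
      using x(2) W.vle_divide_iff[OF s] by (simp add: s_def W.in_val_ring_iff)
    then obtain e where e: "\<forall>b\<in>B. e b \<in> val_ring v" "W.vlt 1 (a' / s - (\<Sum>b\<in>B. \<iota> (e b) * b))"
      using B unfolding residue_basis_iff W.residually_zero_iff by blast
    define c' where "c' i = c i + (if fst i = r then x * e (snd i) else 0)" for i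
    have "(\<Sum>i\<in>R \<times> B. \<iota> (if fst i = r then x * e (snd i) else 0) * ?d i) =
        (\<Sum>r'\<in>R. if r' = r then \<Sum>b\<in>B. \<iota> (x * e b) * (r' * b) else 0)"
      unfolding sum.cartesian_product' by (intro sum.cong) (auto intro!: sum.neutral)
    also have "\<dots> = s * (\<Sum>b\<in>B. \<iota> (e b) * b)"
      using fin r by (simp add: s_def sum_distrib_left hom_mult algebra_simps)
    finally have "(\<Sum>i\<in>R \<times> B. \<iota> (c' i) * ?d i) = (\<Sum>i\<in>R \<times> B. \<iota> (c i) * ?d i) + s * (\<Sum>b\<in>B. \<iota> (e b) * b)"
      by (simp add: c'_def hom_add distrib_right sum.distrib)
    then have "a - (\<Sum>i\<in>R \<times> B. \<iota> (c' i) * ?d i) = (a' / s - (\<Sum>b\<in>B. \<iota> (e b) * b)) * s"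
      using s by (simp add: a'_def field_simps)
    then have "W.vle ((a' / s - (\<Sum>b\<in>B. \<iota> (e b) * b)) * s) a'"
      using c[of c'] by (simp add: a'_def)
    also have "W.vle a' (1 * s)" using x(1) by (simp add: s_def)
    finally show False using W.vle_mult_right_cancel[OF s] e(2) by blast
  qed
  then show ?thesis unfolding a'_def by auto
qed

definition coset :: "'b \<Rightarrow> 'g set" where
  "coset y = (\<lambda>\<gamma>. w y + \<gamma>) ` value_group v"

lemma coset_eq_iff:
  assumes "y \<noteq> 0" "y' \<noteq> 0"
  shows "coset y = coset y' \<longleftrightarrow> (\<exists>x. W.vle y' (\<iota> x * y) \<and> W.vle (\<iota> x * y) y')"
proof -
  have "coset y = coset y' \<longleftrightarrow> (\<exists>x. x \<noteq> 0 \<and> w y' = w y + v x)"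
  proof
    assume eq: "coset y = coset y'"
    have "w y' + v 1 \<in> coset y'" unfolding coset_def value_group_def by (intro imageI) simp
    then have "w y' \<in> coset y" using eq by simp
    then show "\<exists>x. x \<noteq> 0 \<and> w y' = w y + v x" unfolding coset_def value_group_def by auto
  next
    assume "\<exists>x. x \<noteq> 0 \<and> w y' = w y + v x"
    then obtain x where x: "x \<noteq> 0" "w y' = w y + v x" by blast
    have "w y + v z \<in> coset y'" if "z \<noteq> 0" for z
    proof -
      have "w y + v z = w y' + v (z / x)" using that x by (simp add: V.val_divide)
      moreover have "z / x \<noteq> 0" using that x by simp
      ultimately show ?thesis unfolding coset_def value_group_def by blast
    qed
    moreover have "w y' + v z \<in> coset y" if "z \<noteq> 0" for z
    proof -
      have "w y' + v z = w y + v (x * z)" using that x by (simp add: V.val_mult add.assoc)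
      moreover have "x * z \<noteq> 0" using that x by simp
      ultimately show ?thesis unfolding coset_def value_group_def by blast
    qed
    ultimately show "coset y = coset y'" unfolding coset_def value_group_def by blast
  qed
  also have "\<dots> \<longleftrightarrow> (\<exists>x. x \<noteq> 0 \<and> w y' = w (\<iota> x * y))"
    using assms by (intro ex_cong) (simp add: W.val_mult val_hom add.commute)
  also have "\<dots> \<longleftrightarrow> (\<exists>x. W.vle y' (\<iota> x * y) \<and> W.vle (\<iota> x * y) y')"
  proof (intro ex_cong1 iffI)
    fix x assume "x \<noteq> 0 \<and> w y' = w (\<iota> x * y)"
    then show "W.vle y' (\<iota> x * y) \<and> W.vle (\<iota> x * y) y'"
      using assms W.val_eq_iff[of y' "\<iota> x * y"] by simp
  next
    fix x assume x: "W.vle y' (\<iota> x * y) \<and> W.vle (\<iota> x * y) y'"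
    then have "x \<noteq> 0" using assms by auto
    then show "x \<noteq> 0 \<and> w y' = w (\<iota> x * y)"
      using x assms W.val_eq_iff[of y' "\<iota> x * y"] by simp
  qed
  finally show ?thesis .
qed

lemma ram_index_eq: "ram_index v w = card (coset ` {y. y \<noteq> 0})"
  unfolding ram_index_def value_group_def coset_def by (simp add: image_image)

lemma exists_value_basis:
  "\<exists>R. value_independent R \<and> card R = ram_index v w \<and>
    (\<forall>y. y \<noteq> 0 \<longrightarrow> (\<exists>r\<in>R. \<exists>x. W.vle y (\<iota> x * r) \<and> W.vle (\<iota> x * r) y))"
proof -
  define rep where "rep = inv_into {y. y \<noteq> 0} coset"
  let ?C = "coset ` {y. y \<noteq> 0}"
  have rep: "rep X \<noteq> 0" "coset (rep X) = X" if "X \<in> ?C" for X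
    using inv_into_into[OF that] f_inv_into_f[OF that] unfolding rep_def by auto
  have inj: "inj_on rep ?C" by (rule inj_on_inverseI[of _ coset]) (rule rep(2))
  have indep: "value_independent (rep ` S)" if "finite S" "S \<subseteq> ?C" for S
    unfolding value_independent_def
  proof (intro conjI ballI allI impI)
    fix r r' x assume r: "r \<in> rep ` S" "r' \<in> rep ` S"
      and x: "W.vle r' (\<iota> x * r)" "W.vle (\<iota> x * r) r'"
    obtain X X' where X: "r = rep X" "X \<in> S" "r' = rep X'" "X' \<in> S" using r by (elim imageE)
    have XC: "X \<in> ?C" "X' \<in> ?C" using X that(2) by (simp_all only: subsetD)
    have "coset (rep X) = coset (rep X')"
      using coset_eq_iff[OF rep(1)[OF XC(1)] rep(1)[OF XC(2)]] x unfolding X by blast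
    then show "r = r'" by (simp add: X rep(2) XC)
  qed (use that rep in auto)
  \<comment> \<open>Otherwise \<open>deg + 1\<close> cosets would have value-independent
    representatives. Finiteness matters because \<open>card\<close> is 0 on infinite sets.\<close>
  have "finite ?C"
  proof (rule ccontr)
    assume "infinite ?C"
    then obtain S where S: "finite S" "card S = Suc deg" "S \<subseteq> ?C"
      using infinite_arbitrarily_large[OF \<open>infinite ?C\<close>, of "Suc deg"] by (elim exE conjE)
    then have "card (rep ` S) = Suc deg" using card_image[OF inj_on_subset[OF inj S(3)]] by simp
    then show False using value_independent_card_le[OF indep[OF S(1,3)]] by simp
  qed
  show ?thesis
  proof (intro exI[of _ "rep ` ?C"] conjI allI impI)
    show "value_independent (rep ` ?C)" using indep \<open>finite ?C\<close> by blast
    show "card (rep ` ?C) = ram_index v w" unfolding ram_index_eq by (rule card_image[OF inj])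
    fix y :: 'b assume "y \<noteq> 0"
    then have y: "coset y \<in> ?C" by blast
    have "coset (rep (coset y)) = coset y" using rep(2)[OF y] .
    then have "\<exists>x. W.vle y (\<iota> x * rep (coset y)) \<and> W.vle (\<iota> x * rep (coset y)) y"
      using coset_eq_iff[OF rep(1)[OF y] \<open>y \<noteq> 0\<close>] by blast
    then show "\<exists>r\<in>rep ` ?C. \<exists>x. W.vle y (\<iota> x * r) \<and> W.vle (\<iota> x * r) y"
      using y by blast
  qed
qed

theorem fundamental_equality: "ext_degree \<iota> = ram_index v w * res_degree v \<iota> w"
proof -
  obtain R where R: "value_independent R" "card R = ram_index v w"
    "\<And>y. y \<noteq> 0 \<Longrightarrow> \<exists>r\<in>R. \<exists>x. W.vle y (\<iota> x * r) \<and> W.vle (\<iota> x * r) y"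
    using exists_value_basis by blast
  have "\<exists>d B. residue_basis v \<iota> w B \<and> card B = d" using exists_residue_basis by blast
  then obtain B where B: "residue_basis v \<iota> w B" "card B = res_degree v \<iota> w"
    using LeastI_ex[of "\<lambda>d. \<exists>B. residue_basis v \<iota> w B \<and> card B = d"] unfolding res_degree_def by blast
  have "orthogonal (R \<times> B) (\<lambda>(r, b). r * b)"
    using orthogonal_product[OF R(1)] B(1) residue_basis_iff by blast
  from orthogonal_card_eq[OF this product_spanning[OF R(1) B(1) R(3)]] show ?thesis
    by (simp add: card_cartesian_product R(2) B(2) deg_eq)
qed

section \<open>Maximization under constraints and extremality of \<open>w\<close>\<close>

text \<open>The two summands have different values unless both vanish, since otherwise
  \<open>\<theta>\<close> would have the value of \<open>x / y\<close>. So the sum takes the smaller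
  value.\<close>

lemma two_values:
  assumes th: "\<theta> \<noteq> 0" "\<And>x. \<not> (W.vle \<theta> (\<iota> x) \<and> W.vle (\<iota> x) \<theta>)"
  shows "W.vle (\<iota> x + \<theta> * \<iota> y) (\<iota> x)" "W.vle (\<iota> x + \<theta> * \<iota> y) (\<theta> * \<iota> y)"
proof -
  consider "x = 0" "y = 0" | "W.vlt (\<iota> x) (\<theta> * \<iota> y)" | "W.vlt (\<theta> * \<iota> y) (\<iota> x)"
  proof -
    have False if le: "W.vle (\<iota> x) (\<theta> * \<iota> y)" "W.vle (\<theta> * \<iota> y) (\<iota> x)" and "\<not> (x = 0 \<and> y = 0)"
    proof -
      have y: "\<iota> y \<noteq> 0" using that th(1) by auto
      have "\<iota> x = \<iota> (x / y) * \<iota> y" using y by (simp flip: hom_mult)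
      then show False using le th(2)[of "x / y"] W.vle_mult_right_cancel[OF y] by simp
    qed
    then show ?thesis using that by blast
  qed
  then have "W.vle (\<iota> x + \<theta> * \<iota> y) (\<iota> x) \<and> W.vle (\<iota> x + \<theta> * \<iota> y) (\<theta> * \<iota> y)"
  proof cases
    case 2
    then show ?thesis using W.vle_add_vlt W.vlt_imp_vle W.vle_trans by meson
  next
    case 3
    then have le: "W.vle (\<theta> * \<iota> y + \<iota> x) (\<theta> * \<iota> y)" by (rule W.vle_add_vlt)
    then show ?thesis using W.vle_trans[OF le W.vlt_imp_vle[OF 3]] by (simp add: add.commute)
  qed simp
  then show "W.vle (\<iota> x + \<theta> * \<iota> y) (\<iota> x)" "W.vle (\<iota> x + \<theta> * \<iota> y) (\<theta> * \<iota> y)" by blast+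
qed

text \<open>Each constraint \<open>P\<^sub>j \<in> O\<close> is turned into a penalty \<open>\<theta> A (P\<^sub>j - t\<^sub>j)\<close> with a fresh variable
  \<open>t\<^sub>j\<close>, where \<open>j\<close> itself serves as the index of that variable. Since \<open>w \<theta>\<close> is not a value of
  \<open>K\<close>, the penalty and the (norm of the) objective cannot cancel.\<close>

lemma constrained_max:
  assumes th: "\<theta> \<noteq> 0" "\<And>x. \<not> (W.vle \<theta> (\<iota> x) \<and> W.vle (\<iota> x) \<theta>)"
    and J: "finite J" "\<And>j. j \<in> J \<Longrightarrow> P j \<in> polyfun (\<lambda>x. x) I"
      "\<And>j. j \<in> J \<Longrightarrow> P j (\<lambda>_. 0) \<in> val_ring v"
    and I': "finite I'" "I \<subseteq> I'" "I' \<inter> J = {}" and Q: "Q \<in> polyfun \<iota> I'"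
  shows "\<exists>a. ((\<forall>i\<in>I'. a i \<in> val_ring v) \<and> (\<forall>j\<in>J. P j a \<in> val_ring v)) \<and>
    (\<forall>b. (\<forall>i\<in>I'. b i \<in> val_ring v) \<longrightarrow> (\<forall>j\<in>J. P j b \<in> val_ring v) \<longrightarrow> W.vle (Q b) (Q a))"
  using J I' Q
\<comment> \<open>\<open>I'\<close> and \<open>Q\<close> vary: each step adds the variable
  \<open>j\<close> and replaces \<open>Q\<close> by the penalized \<open>Q'\<close>, while the
  constraints stay functions of \<open>I\<close>.\<close>
proof (induction J arbitrary: I' Q rule: finite_induct)
  case empty
  obtain a where "\<And>i. i \<in> I' \<Longrightarrow> a i \<in> val_ring v"
    "\<And>b. (\<And>i. i \<in> I' \<Longrightarrow> b i \<in> val_ring v) \<Longrightarrow> W.vle (Q b) (Q a)"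
    by (rule polyfun_ext_max[OF \<open>finite I'\<close> empty.prems(6)]) blast
  then show ?case by (intro exI[of _ a]) simp
next
  case (insert j J)
  define feas where "feas b \<longleftrightarrow> (\<forall>i\<in>I'. b i \<in> val_ring v) \<and> (\<forall>j\<in>insert j J. P j b \<in> val_ring v)" for b
  have "\<exists>a. feas a \<and> (\<forall>b. feas b \<longrightarrow> W.vle (Q b) (Q a))"
  proof (cases "\<forall>b. feas b \<longrightarrow> Q b = 0")
    case True
    moreover have "feas (\<lambda>_. 0)" using insert.prems(2) by (simp add: feas_def)
    ultimately show ?thesis by (intro exI[of _ "\<lambda>_. 0"]) simp
  next
    case False
    then obtain b0 where b0: "feas b0" "Q b0 \<noteq> 0" by blast
    \<comment> \<open>\<open>\<theta> * \<iota> A\<close> has value at most that of the norm of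
      \<open>Q b0\<close>; a violated constraint gives the penalty a still smaller value, so such a
      point does worse than \<open>b0\<close>.\<close>
    obtain A where A: "A \<noteq> 0" "W.vle (\<iota> A) (\<iota> (nrm (Q b0)) / \<theta>)"
      using exists_small_scalar[of "{\<iota> (nrm (Q b0)) / \<theta>}"] b0 th(1) by auto
    \<comment> \<open>The norm moves the objective into \<open>K\<close>, as
      \<open>two_values\<close> demands.\<close>
    define Q' where "Q' a = \<iota> (nrm (Q a)) + \<theta> * \<iota> (A * (P j a - a j))" for a
    have Pj: "P j \<in> polyfun (\<lambda>x. x) (insert j I')"
      using polyfun_mono[OF insert.prems(1)[of j], of "insert j I'"] insert.prems(4) by blast
    have "(\<lambda>a. nrm (Q a)) \<in> polyfun (\<lambda>x. x) (insert j I')"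
      using polyfun_mono[OF polyfun_nrm[OF insert.prems(6)], of "insert j I'"] by blast
    then have Q': "Q' \<in> polyfun \<iota> (insert j I')"
      unfolding Q'_def
      by (intro polyfun.add polyfun.mult[OF polyfun.const] polyfun_hom polyfun_diff Pj
          polyfun.var[where \<phi> = "\<lambda>x. x"]) simp_all
    have jI': "j \<notin> I'" using insert.prems(5) by blast
    have "\<exists>a. ((\<forall>i\<in>insert j I'. a i \<in> val_ring v) \<and> (\<forall>j\<in>J. P j a \<in> val_ring v)) \<and>
      (\<forall>b. (\<forall>i\<in>insert j I'. b i \<in> val_ring v) \<longrightarrow> (\<forall>j\<in>J. P j b \<in> val_ring v) \<longrightarrow>
        W.vle (Q' b) (Q' a))"
    proof (rule insert.IH[OF _ _ _ _ _ Q'])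
      show "insert j I' \<inter> J = {}" using insert.prems(5) insert.hyps(2) by blast
    qed (use insert.prems(1-4) in auto)
    then obtain a where a: "\<forall>i\<in>insert j I'. a i \<in> val_ring v" "\<forall>j\<in>J. P j a \<in> val_ring v"
      and max: "\<And>b. (\<forall>i\<in>insert j I'. b i \<in> val_ring v) \<Longrightarrow> (\<forall>j\<in>J. P j b \<in> val_ring v) \<Longrightarrow> W.vle (Q' b) (Q' a)"
      by blast
    have le: "W.vle (\<iota> (nrm (Q b))) (Q' a)" if b: "feas b" for b
    proof -
      \<comment> \<open>Giving the fresh variable the value \<open>P j b\<close> makes the penalty
        vanish; the constraints and \<open>Q\<close> do not depend on that variable.\<close>
      define b' where "b' = b(j := P j b)"
      have b'I: "b' i = b i" if "i \<in> I'" for i using that jI' by (auto simp: b'_def)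
      have Pb': "P k b' = P k b" if "k \<in> insert j J" for k
        using insert.prems(1)[OF that] by (rule polyfun_cong) (use b'I insert.prems(4) in blast)
      have "Q b' = Q b" using insert.prems(6) by (rule polyfun_cong) (rule b'I)
      then have "Q' b' = \<iota> (nrm (Q b))" using Pb'[of j] by (simp add: Q'_def) (simp add: b'_def)
      moreover have "W.vle (Q' b') (Q' a)"
      proof (rule max)
        show "\<forall>i\<in>insert j I'. b' i \<in> val_ring v" using b b'I by (auto simp: feas_def) (simp add: b'_def)
        show "\<forall>j\<in>J. P j b' \<in> val_ring v" using b Pb' by (auto simp: feas_def)
      qed
      ultimately show ?thesis by simp
    qed
    have "P j a \<in> val_ring v"
    proof (rule ccontr)
      assume "P j a \<notin> val_ring v"
      then have Pja: "V.vlt (P j a) 1" by (simp add: V.in_val_ring_iff)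
      \<comment> \<open>\<open>a j\<close> is integral and \<open>P j a\<close> is not, so their
        difference has negative value as well.\<close>
      then have "V.vlt (P j a) (- a j)"
        using a(1) V.vle_trans[of 1 "a j" "P j a"] by (auto simp: V.in_val_ring_iff)
      then have "V.vle (P j a - a j) (P j a)" using V.vle_add_vlt by fastforce
      then have n: "V.vlt (P j a - a j) 1" using Pja V.vle_trans by blast
      have "W.vle (\<theta> * \<iota> A) (\<iota> (nrm (Q b0)))"
        using W.vle_mult_left[OF A(2), of \<theta>] th(1) by simp
      also note le[OF b0(1)]
      also have "W.vle (Q' a) (\<theta> * \<iota> (A * (P j a - a j)))"
        unfolding Q'_def by (rule two_values(2)[OF th])
      finally have "W.vle (\<theta> * \<iota> A * 1) (\<theta> * \<iota> A * \<iota> (P j a - a j))"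
        by (simp add: hom_mult mult.assoc)
      then have "W.vle 1 (\<iota> (P j a - a j))"
        using W.vle_mult_left_cancel[of "\<theta> * \<iota> A" 1 "\<iota> (P j a - a j)"] th(1) A(1) by simp
      then show False using n by simp
    qed
    then have "feas a" using a by (simp add: feas_def)
    moreover have "W.vle (Q b) (Q a)" if "feas b" for b
    proof -
      have "W.vle (Q' a) (\<iota> (nrm (Q a)))" unfolding Q'_def by (rule two_values(1)[OF th])
      with le[OF that] have "W.vle (\<iota> (nrm (Q b))) (\<iota> (nrm (Q a)))" by (rule W.vle_trans)
      then show ?thesis by (simp add: nrm_vle_iff)
    qed
    ultimately show ?thesis by blast
  qed
  then show ?case unfolding feas_def by blast
qed

text \<open>\<open>Y\<close> maps \<open>S n\<close> onto the \<open>n\<close>-tuples from the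
  valuation ring of \<open>w\<close>, so a maximum of the polynomial function \<open>F\<close>
  composed with \<open>Y\<close> is one of \<open>F\<close>. Both cases of
  \<open>extremal_extension\<close> have this shape.\<close>

lemma extremal_of_parametrization:
  fixes Y :: "('i \<Rightarrow> 'a) \<Rightarrow> nat \<Rightarrow> 'b"
  assumes max: "\<And>n Q. Q \<in> polyfun \<iota> (I n) \<Longrightarrow> \<exists>a\<in>S n. \<forall>b\<in>S n. W.vle (Q b) (Q a)"
    and Y: "\<And>n j. j < n \<Longrightarrow> (\<lambda>a. Y a j) \<in> polyfun \<iota> (I n)"
      "\<And>n a j. a \<in> S n \<Longrightarrow> j < n \<Longrightarrow> Y a j \<in> val_ring w"
      "\<And>n y. (\<And>j. j < n \<Longrightarrow> y j \<in> val_ring w) \<Longrightarrow> \<exists>a\<in>S n. \<forall>j<n. Y a j = y j"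
  shows "extremal w"
  unfolding extremal_iff_vle[OF W.valuation]
proof (intro allI impI)
  fix n :: nat and F :: "(nat \<Rightarrow>\<^sub>0 nat) \<Rightarrow>\<^sub>0 'b"
  assume F: "mpoly_in_vars n F"
  have "(\<lambda>a. mpoly_eval F (\<lambda>j. Y a j)) \<in> polyfun \<iota> (I n)"
    using F Y(1) by (rule polyfun_mpoly_eval)
  then obtain a where a: "a \<in> S n" "\<And>b. b \<in> S n \<Longrightarrow> W.vle (mpoly_eval F (Y b)) (mpoly_eval F (Y a))"
    using max by blast
  show "\<exists>a. (\<forall>i<n. a i \<in> val_ring w) \<and>
      (\<forall>b. (\<forall>i<n. b i \<in> val_ring w) \<longrightarrow> W.vle (mpoly_eval F b) (mpoly_eval F a))"
  proof (intro exI[of _ "Y a"] conjI allI impI)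
    fix y assume "\<forall>i<n. y i \<in> val_ring w"
    then obtain b where b: "b \<in> S n" "\<forall>j<n. Y b j = y j" using Y(3)[of n y] by blast
    have "mpoly_eval F y = mpoly_eval F (Y b)" by (rule mpoly_eval_cong[OF F]) (simp add: b(2))
    then show "W.vle (mpoly_eval F y) (mpoly_eval F (Y a))" using a(2)[OF b(1)] by simp
  qed (use Y(2) a(1) in blast)
qed

text \<open>By orthogonality each term \<open>\<iota> (c i) * d i\<close> has value at least that of
  \<open>y\<close>, hence at least that of \<open>\<iota> C * d i\<close>; cancel
  \<open>d i\<close>.\<close>

lemma orthogonal_bounded_coeffs:
  assumes d: "orthogonal I d" and span: "\<And>y. \<exists>c. y = (\<Sum>i\<in>I. \<iota> (c i) * d i)"
    and C: "C \<noteq> 0" "\<And>i. i \<in> I \<Longrightarrow> W.vle (\<iota> C * d i) 1" and y: "y \<in> val_ring w"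
  shows "\<exists>c. (\<forall>i\<in>I. c i \<in> val_ring v) \<and> y = (\<Sum>i\<in>I. \<iota> C * \<iota> (c i) * d i)"
proof -
  obtain c where c: "y = (\<Sum>i\<in>I. \<iota> (c i) * d i)" using span by blast
  have "c i / C \<in> val_ring v" if i: "i \<in> I" for i
  proof -
    have "W.vle (\<iota> C * d i) 1" by (rule C(2)[OF i])
    also have "W.vle 1 y" using y by (simp add: W.in_val_ring_iff)
    also have "W.vle y (\<iota> (c i) * d i)" using d i unfolding c orthogonal_def by blast
    finally have "V.vle C (c i)"
      using d i W.vle_mult_right_cancel[of "d i"] by (auto simp: orthogonal_def)
    then show ?thesis using V.vle_divide_iff[OF C(1)] by (simp add: V.in_val_ring_iff)
  qed
  moreover have "y = (\<Sum>i\<in>I. \<iota> C * \<iota> (c i / C) * d i)"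
    unfolding c using C(1) by (simp flip: hom_mult)
  ultimately show ?thesis by (intro exI[of _ "\<lambda>i. c i / C"] conjI ballI)
qed

theorem extremal_extension: "extremal w"
proof -
  obtain R where R: "value_independent R"
    "\<And>y. y \<noteq> 0 \<Longrightarrow> \<exists>r\<in>R. \<exists>x. W.vle y (\<iota> x * r) \<and> W.vle (\<iota> x * r) y"
    using exists_value_basis by blast
  obtain B where B: "residue_basis v \<iota> w B" using exists_residue_basis by blast
  then have B': "residually_independent B" using residue_basis_iff by blast
  show ?thesis
  \<comment> \<open>\<open>\<theta>\<close> witnesses a value of \<open>w\<close> outside the value
    group of \<open>K\<close>.\<close>
  proof (cases "\<exists>\<theta>. \<theta> \<noteq> 0 \<and> (\<forall>x. \<not> (W.vle \<theta> (\<iota> x) \<and> W.vle (\<iota> x) \<theta>))")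
    case True
    then obtain \<theta> where th: "\<theta> \<noteq> 0" "\<And>x. \<not> (W.vle \<theta> (\<iota> x) \<and> W.vle (\<iota> x) \<theta>)" by blast
    define I where "I = R \<times> B"
    define d :: "'b \<times> 'b \<Rightarrow> 'b" where "d = (\<lambda>(r, b). r * b)"
    have d: "orthogonal I d" unfolding I_def d_def by (rule orthogonal_product[OF R(1) B'])
    have span: "\<exists>c. y = (\<Sum>i\<in>I. \<iota> (c i) * d i)" for y
      unfolding I_def d_def by (rule product_spanning[OF R(1) B R(2)])
    have fin: "finite I" and dnz: "\<And>i. i \<in> I \<Longrightarrow> d i \<noteq> 0" using d by (auto simp: orthogonal_def)
    have "finite ((\<lambda>i. inverse (d i)) ` I)" "0 \<notin> (\<lambda>i. inverse (d i)) ` I"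
      using fin dnz by auto
    then obtain C where C: "C \<noteq> 0" "\<And>y. y \<in> (\<lambda>i. inverse (d i)) ` I \<Longrightarrow> W.vle (\<iota> C) y"
      by (rule exists_small_scalar) blast
    have C': "W.vle (\<iota> C * d i) 1" if "i \<in> I" for i
      using W.vle_mult_right[OF C(2)[of "inverse (d i)"], of "d i"] dnz[OF that] that by simp
    \<comment> \<open>\<open>Inl (j, i)\<close> is coordinate \<open>i\<close> of argument
      \<open>j\<close>; \<open>Inr j\<close> labels the constraint on argument \<open>j\<close> and
      its penalty variable.\<close>
    define Y where "Y a j = (\<Sum>i\<in>I. \<iota> C * \<iota> (a (Inl (j, i))) * d i)"
      for a :: "(nat \<times> 'b \<times> 'b) + nat \<Rightarrow> 'a" and j
    define In :: "nat \<Rightarrow> ((nat \<times> 'b \<times> 'b) + nat) set" where "In n = Inl ` ({..<n} \<times> I)" for n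
    define P :: "(nat \<times> 'b \<times> 'b) + nat \<Rightarrow> ((nat \<times> 'b \<times> 'b) + nat \<Rightarrow> 'a) \<Rightarrow> 'a"
      where "P k a = nrm (Y a (projr k))" for k a
    define S where "S n = {a. (\<forall>i\<in>In n. a i \<in> val_ring v) \<and> (\<forall>k\<in>Inr ` {..<n}. P k a \<in> val_ring v)}" for n
    have Y: "(\<lambda>a. Y a j) \<in> polyfun \<iota> (In n)" if "j < n" for n j
      unfolding Y_def using that
      by (intro polyfun_sum polyfun.mult polyfun.const polyfun.var) (auto simp: In_def)
    \<comment> \<open>Membership in the valuation ring of \<open>w\<close> becomes a condition on a
      polynomial function over \<open>K\<close>, as \<open>constrained_max\<close> requires.\<close>
    have P: "P (Inr j) a \<in> val_ring v \<longleftrightarrow> Y a j \<in> val_ring w" for j a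
      using nrm_vle_iff[of 1 "Y a j"] by (simp add: P_def V.in_val_ring_iff W.in_val_ring_iff)
    show ?thesis
    proof (rule extremal_of_parametrization[of In S Y])
      fix n Q assume Q: "Q \<in> polyfun \<iota> (In n)"
      have "\<exists>a. ((\<forall>i\<in>In n. a i \<in> val_ring v) \<and> (\<forall>j\<in>Inr ` {..<n}. P j a \<in> val_ring v)) \<and>
        (\<forall>b. (\<forall>i\<in>In n. b i \<in> val_ring v) \<longrightarrow> (\<forall>j\<in>Inr ` {..<n}. P j b \<in> val_ring v) \<longrightarrow> W.vle (Q b) (Q a))"
      proof (rule constrained_max[OF th _ _ _ _ _ _ Q, where I = "In n"])
        fix k assume "k \<in> (Inr ` {..<n} :: ((nat \<times> 'b \<times> 'b) + nat) set)"
        then obtain j where k: "k = Inr j" "j < n" by blast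
        show "P k \<in> polyfun (\<lambda>x. x) (In n)"
          using polyfun_nrm[OF Y[OF k(2)]] unfolding P_def k by simp
        show "P k (\<lambda>_. 0) \<in> val_ring v" unfolding k P by (simp add: Y_def)
      qed (auto simp: In_def fin)
      then obtain a where a: "\<forall>i\<in>In n. a i \<in> val_ring v" "\<forall>j\<in>Inr ` {..<n}. P j a \<in> val_ring v"
        and max: "\<forall>b. (\<forall>i\<in>In n. b i \<in> val_ring v) \<longrightarrow>
          (\<forall>j\<in>Inr ` {..<n}. P j b \<in> val_ring v) \<longrightarrow> W.vle (Q b) (Q a)"
        by (elim exE conjE)
      show "\<exists>a\<in>S n. \<forall>b\<in>S n. W.vle (Q b) (Q a)"
        by (rule bexI[of _ a]) (use a max in \<open>simp_all add: S_def\<close>)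
    next
      fix n a j assume "a \<in> S n" "j < n"
      then show "Y a j \<in> val_ring w" using P by (auto simp: S_def)
    next
      fix n and y :: "nat \<Rightarrow> 'b" assume y: "\<And>j. j < n \<Longrightarrow> y j \<in> val_ring w"
      have "\<forall>j. \<exists>c. j < n \<longrightarrow> (\<forall>i\<in>I. c i \<in> val_ring v) \<and> y j = (\<Sum>i\<in>I. \<iota> C * \<iota> (c i) * d i)"
        using orthogonal_bounded_coeffs[OF d span C(1) C' y] by blast
      from choice[OF this] obtain c where c: "\<And>j. j < n \<Longrightarrow> \<forall>i\<in>I. c j i \<in> val_ring v"
        "\<And>j. j < n \<Longrightarrow> y j = (\<Sum>i\<in>I. \<iota> C * \<iota> (c j i) * d i)" by blast
      define a where "a k = (case k of Inl (j, i) \<Rightarrow> c j i | Inr _ \<Rightarrow> 0)" for k :: "(nat \<times> 'b \<times> 'b) + nat"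
      have Ya: "Y a j = y j" if "j < n" for j using c(2)[OF that] by (simp add: Y_def a_def)
      have "a \<in> S n" unfolding S_def using c(1) Ya y by (auto simp: P In_def) (simp add: a_def)
      with Ya show "\<exists>a\<in>S n. \<forall>j<n. Y a j = y j" by blast
    qed (rule Y)
  next
    case False
    define d :: "'b \<times> 'b \<Rightarrow> 'b" where "d = (\<lambda>(r, b). r * b)"
    \<comment> \<open>Equal value groups: the single coset representative \<open>1\<close> and the
      scalar \<open>C = 1\<close> serve, and integral coordinates always give integral
      elements.\<close>
    define I where "I = {1::'b} \<times> B"
    have R1: "value_independent {1}" by (simp add: value_independent_def)
    have d: "orthogonal I d" unfolding I_def d_def by (rule orthogonal_product[OF R1 B'])
    have span: "\<exists>c. y = (\<Sum>i\<in>I. \<iota> (c i) * d i)" for y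
      unfolding I_def d_def by (rule product_spanning[OF R1 B]) (use False in auto)
    have BO: "B \<subseteq> val_ring w" using B' by (simp add: residually_independent_def)
    have fin: "finite I" using d by (simp add: orthogonal_def)
    have d1: "W.vle (\<iota> 1 * d i) 1" and dO: "d i \<in> val_ring w" if "i \<in> I" for i
      using that residually_independent_unit[OF B'] BO by (auto simp: I_def d_def)
    define Y where "Y a j = (\<Sum>i\<in>I. \<iota> 1 * \<iota> (a (j, i)) * d i)"
      for a :: "nat \<times> 'b \<times> 'b \<Rightarrow> 'a" and j
    define In where "In n = {..<n} \<times> I" for n :: nat
    define S where "S n = {a. \<forall>i\<in>In n. a i \<in> val_ring v}" for n
    show ?thesis
    proof (rule extremal_of_parametrization[of In S Y])
      fix n Q assume "Q \<in> polyfun \<iota> (In n)"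
      moreover have "finite (In n)" using fin by (simp add: In_def)
      ultimately obtain a where "\<And>i. i \<in> In n \<Longrightarrow> a i \<in> val_ring v"
        "\<And>b. (\<And>i. i \<in> In n \<Longrightarrow> b i \<in> val_ring v) \<Longrightarrow> W.vle (Q b) (Q a)"
        using polyfun_ext_max by blast
      then show "\<exists>a\<in>S n. \<forall>b\<in>S n. W.vle (Q b) (Q a)" unfolding S_def by blast
    next
      fix n j :: nat assume "j < n"
      then show "(\<lambda>a. Y a j) \<in> polyfun \<iota> (In n)"
        unfolding Y_def
        by (intro polyfun_sum polyfun.mult polyfun.const polyfun.var) (auto simp: In_def)
    next
      fix n a j assume "a \<in> S n" "j < n"
      then show "Y a j \<in> val_ring w"
        unfolding Y_def by (intro W.val_ring_sum W.val_ring_mult dO) (auto simp: S_def In_def)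
    next
      fix n and y :: "nat \<Rightarrow> 'b" assume y: "\<And>j. j < n \<Longrightarrow> y j \<in> val_ring w"
      have "\<forall>j. \<exists>c. j < n \<longrightarrow> (\<forall>i\<in>I. c i \<in> val_ring v) \<and> y j = (\<Sum>i\<in>I. \<iota> 1 * \<iota> (c i) * d i)"
        using orthogonal_bounded_coeffs[OF d span one_neq_zero d1 y] by blast
      from choice[OF this] obtain c where c: "\<And>j. j < n \<Longrightarrow> \<forall>i\<in>I. c j i \<in> val_ring v"
        "\<And>j. j < n \<Longrightarrow> y j = (\<Sum>i\<in>I. \<iota> 1 * \<iota> (c j i) * d i)" by blast
      have "Y (\<lambda>(j, i). c j i) j = y j" if "j < n" for j using c(2)[OF that] by (simp add: Y_def)
      moreover have "(\<lambda>(j, i). c j i) \<in> S n" using c(1) by (auto simp: S_def In_def)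
      ultimately show "\<exists>a\<in>S n. \<forall>j<n. Y a j = y j" by blast
    qed
  qed
qed

end

theorem theorem3p11:
  fixes v :: "'a::field \<Rightarrow> 'g::linordered_ab_group_add"
  assumes "valuation v" and "extremal v"
  shows "algebraically_complete v TYPE('b::field) \<and>
         (\<forall>(\<iota>::'a \<Rightarrow> 'b) (w::'b \<Rightarrow> 'g). valued_finite_ext v \<iota> w \<longrightarrow> extremal w)"
proof -
  interpret extremal_valued v
    by unfold_locales (use assms in auto)
  have ext: "extremal_extension v \<iota> w" if "valued_finite_ext v \<iota> w" for \<iota> :: "'a \<Rightarrow> 'b" and w
    using that unfolding valued_finite_ext_def by unfold_locales auto
  show ?thesis
    unfolding algebraically_complete_def
    using henselian extremal_extension.fundamental_equality[OF ext]
      extremal_extension.extremal_extension[OF ext] by blast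
qed

end
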